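(* Let $K$ be a field, $S=K[x_1,\ldots,x_n]$, $I$ a monomial ideal of $S$, and let $u_1,\ldots,u_c$ be monomials in $S$ forming a regular sequence on $S/I$. Then each of the following three equivalences holds: (1) $S/I$ is clean if and only if $S/(I,u_1,\ldots,u_c)$ is clean; (2) $S/I$ is pretty clean if and only if $S/(I,u_1,\ldots,u_c)$ is pretty clean; (3) $S/I$ is almost clean if and only if $S/(I,u_1,\ldots,u_c)$ is almost clean.
   Context: $S=K[x_1,\ldots,x_n]$ carries its standard $\mathbb{Z}^n$-grading (``multigrading''). A (multigraded) prime filtration of a finitely generated multigraded $S$-module $M$ is a finite filtration $\mathcal{F}: 0=M_0\subset M_1\subset\cdots\subset M_r=M$ by multigraded submodules such that there are multigraded isomorphisms $M_i/M_{i-1}\cong S/\mathfrak{p}_i(-a_i)$ with $a_i\in\mathbb{Z}^n$ and $\mathfrak{p}_i$ a multigraded prime ideal of $S$. Put $\operatorname{Supp}\mathcal{F}=\{\mathfrak{p}_1,\ldots,\mathfrak{p}_r\}$, and let $\operatorname{Min} M$ be the set of minimal elements of $\operatorname{Supp}_S M$. The filtration $\mathcal{F}$ is called clean if $\operatorname{Supp}\mathcal{F}=\operatorname{Min} M$; pretty clean if for all $i<j$ with $\mathfrak{p}_i\subseteq\mathfrak{p}_j$ one has $\mathfrak{p}_i=\mathfrak{p}_j$; almost clean if $\operatorname{Supp}\mathcal{F}=\operatorname{Ass}_S M$. The module $M$ is clean (resp. pretty clean, almost clean) if it admits a clean (resp. pretty clean, almost clean) filtration. *)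

theory Defs
  imports "HOL-Algebra.Algebra" "HOL-Algebra.Algebraic_Closure_Type" "HOL-Library.Poly_Mapping"
begin

section \<open>The polynomial ring\<close>

text \<open>
  A polynomial over \<open>K = 'k\<close> in variables indexed by the finite type \<open>'n\<close> (so \<open>n = CARD('n)\<close>) maps
  exponent vectors to coefficients; the product on \<open>\<Rightarrow>\<^sub>0\<close> is convolution.  The ring
  \<open>S\<close> is the library's \<open>ring_of_type_algebra\<close>, a \<open>HOL-Algebra\<close> ring with carrier \<open>UNIV\<close>.
\<close>

type_synonym ('n, 'k) mpoly = "('n \<Rightarrow>\<^sub>0 nat) \<Rightarrow>\<^sub>0 'k"

abbreviation S_ring :: "('n::finite, 'k::field) mpoly ring" where
  "S_ring \<equiv> ring_of_type_algebra"

definition monomials :: "('n::finite, 'k::field) mpoly set" where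
  "monomials = {Poly_Mapping.single m 1 | m. True}"

definition monomial_ideal :: "('n::finite, 'k::field) mpoly set \<Rightarrow> bool" where
  "monomial_ideal I \<longleftrightarrow> (\<exists>G \<subseteq> monomials. I = Idl\<^bsub>S_ring\<^esub> G)"


section \<open>Multigraded modules\<close>

text \<open>\<open>mcomp M a\<close> is the component of \<open>M\<close> of degree \<open>a \<in> \<int>\<^sup>n\<close>.\<close>

record ('r, 'm, 'n) mgmodule = "('r, 'm) module" +
  mcomp :: "('n \<Rightarrow> int) \<Rightarrow> 'm set"

definition S_mod :: "(('n::finite, 'k::field) mpoly, ('n, 'k) mpoly, 'n) mgmodule" where
  "S_mod = \<lparr>carrier = UNIV, monoid.mult = (*), one = 1, ring.zero = 0, add = (+), module.smult = (*),
     mcomp = (\<lambda>a. {f. \<forall>m \<in> Poly_Mapping.keys f. \<forall>i. int (Poly_Mapping.lookup m i) = a i})\<rparr>"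

definition multigraded_module ::
  "(('n::finite, 'k::field) mpoly, 'm, 'n) mgmodule \<Rightarrow> bool" where
  "multigraded_module M \<longleftrightarrow>
     module S_ring M \<and>
     (\<forall>a. additive_subgroup (mcomp M a) M) \<and>
     (\<forall>a b. \<forall>s \<in> mcomp S_mod a. \<forall>x \<in> mcomp M b. s \<odot>\<^bsub>M\<^esub> x \<in> mcomp M (\<lambda>i. a i + b i)) \<and>
     (\<forall>x \<in> carrier M. \<exists>!g. (\<forall>a. g a \<in> mcomp M a) \<and> finite {a. g a \<noteq> \<zero>\<^bsub>M\<^esub>} \<and>
        x = finsum M g {a. g a \<noteq> \<zero>\<^bsub>M\<^esub>})"

definition restrict_mod :: "('r, 'm, 'n) mgmodule \<Rightarrow> 'm set \<Rightarrow> ('r, 'm, 'n) mgmodule" where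
  "restrict_mod M N = M\<lparr>carrier := N, mcomp := (\<lambda>a. mcomp M a \<inter> N)\<rparr>"

definition multigraded_submodule ::
  "'m set \<Rightarrow> (('n::finite, 'k::field) mpoly, 'm, 'n) mgmodule \<Rightarrow> bool" where
  "multigraded_submodule N M \<longleftrightarrow> submodule N S_ring M \<and> multigraded_module (restrict_mod M N)"

text \<open>
  The quotient module, on the additive cosets of \<open>N\<close>.  The fields \<open>mult\<close> and \<open>one\<close>, which the record
  type of modules inherits from rings, play no role for modules.
\<close>

definition quot_mod :: "('r, 'm, 'n) mgmodule \<Rightarrow> 'm set \<Rightarrow> ('r, 'm set, 'n) mgmodule" where
  "quot_mod M N = \<lparr>carrier = a_rcosets\<^bsub>M\<^esub> N, monoid.mult = undefined, one = undefined,
     ring.zero = N, add = set_add M, module.smult = (\<lambda>s C. \<Union>x\<in>C. N +>\<^bsub>M\<^esub> (s \<odot>\<^bsub>M\<^esub> x)),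
     mcomp = (\<lambda>a. (\<lambda>x. N +>\<^bsub>M\<^esub> x) ` mcomp M a)\<rparr>"

text \<open>The twist \<open>M(-a)\<close>, where \<open>M(-a)\<^sub>b = M\<^sub>b\<^sub>-\<^sub>a\<close>.\<close>

definition twist :: "('r, 'm, 'n) mgmodule \<Rightarrow> ('n \<Rightarrow> int) \<Rightarrow> ('r, 'm, 'n) mgmodule" where
  "twist M a = M\<lparr>mcomp := (\<lambda>b. mcomp M (\<lambda>i. b i - a i))\<rparr>"

definition multigraded_iso ::
  "(('n::finite, 'k::field) mpoly, 'm, 'n) mgmodule \<Rightarrow>
   (('n, 'k) mpoly, 'l, 'n) mgmodule \<Rightarrow> bool" where
  "multigraded_iso M N \<longleftrightarrow>
     (\<exists>h. bij_betw h (carrier M) (carrier N) \<and>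
        (\<forall>x \<in> carrier M. \<forall>y \<in> carrier M. h (x \<oplus>\<^bsub>M\<^esub> y) = h x \<oplus>\<^bsub>N\<^esub> h y) \<and>
        (\<forall>s. \<forall>x \<in> carrier M. h (s \<odot>\<^bsub>M\<^esub> x) = s \<odot>\<^bsub>N\<^esub> h x) \<and>
        (\<forall>a. h ` mcomp M a = mcomp N a))"

definition multigraded_prime :: "('n::finite, 'k::field) mpoly set \<Rightarrow> bool" where
  "multigraded_prime p \<longleftrightarrow> primeideal p S_ring \<and> multigraded_submodule p S_mod"


section \<open>Associated primes and support\<close>

definition Ass :: "(('n::finite, 'k::field) mpoly, 'm, 'n) mgmodule \<Rightarrow> ('n, 'k) mpoly set set" where
  "Ass M = {p. primeideal p S_ring \<and> (\<exists>x \<in> carrier M. p = {s. s \<odot>\<^bsub>M\<^esub> x = \<zero>\<^bsub>M\<^esub>})}"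

text \<open>
  Elements of the localization \<open>M\<^sub>p\<close> are the classes of pairs \<open>(x, s)\<close>, standing for
  \<open>x/s\<close>, where \<open>s \<notin> p\<close>; the zero element is the class of \<open>(0, 1)\<close>.
\<close>

definition loc_rel ::
  "(('n::finite, 'k::field) mpoly, 'm, 'n) mgmodule \<Rightarrow> ('n, 'k) mpoly set \<Rightarrow>
   (('m \<times> ('n, 'k) mpoly) \<times> ('m \<times> ('n, 'k) mpoly)) set" where
  "loc_rel M p = {((x, s), (y, t)). x \<in> carrier M \<and> y \<in> carrier M \<and> s \<notin> p \<and> t \<notin> p \<and>
     (\<exists>v. v \<notin> p \<and> v \<odot>\<^bsub>M\<^esub> (t \<odot>\<^bsub>M\<^esub> x) = v \<odot>\<^bsub>M\<^esub> (s \<odot>\<^bsub>M\<^esub> y))}"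

definition localization ::
  "(('n::finite, 'k::field) mpoly, 'm, 'n) mgmodule \<Rightarrow> ('n, 'k) mpoly set \<Rightarrow>
   ('m \<times> ('n, 'k) mpoly) set set" where
  "localization M p = (carrier M \<times> - p) // loc_rel M p"

definition Supp :: "(('n::finite, 'k::field) mpoly, 'm, 'n) mgmodule \<Rightarrow> ('n, 'k) mpoly set set" where
  "Supp M = {p. primeideal p S_ring \<and> localization M p \<noteq> {loc_rel M p `` {(\<zero>\<^bsub>M\<^esub>, 1)}}}"

definition Min_primes ::
  "(('n::finite, 'k::field) mpoly, 'm, 'n) mgmodule \<Rightarrow> ('n, 'k) mpoly set set" where
  "Min_primes M = {p \<in> Supp M. \<forall>q \<in> Supp M. q \<subseteq> p \<longrightarrow> q = p}"


section \<open>Prime filtrations\<close>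

text \<open>
  The filtration is \<open>F 0 \<subset> \<dots> \<subset> F r\<close>, and \<open>P i\<close> is the prime belonging to \<open>F i / F (i - 1)\<close> for
  \<open>1 \<le> i \<le> r\<close>; values at other indices are irrelevant.  The \<open>P i\<close> are determined by \<open>F\<close>
  because \<open>P i\<close> is the annihilator of \<open>F i / F (i - 1)\<close>.
\<close>

definition prime_filtration ::
  "(('n::finite, 'k::field) mpoly, 'm, 'n) mgmodule \<Rightarrow> nat \<Rightarrow> (nat \<Rightarrow> 'm set) \<Rightarrow>
   (nat \<Rightarrow> ('n, 'k) mpoly set) \<Rightarrow> bool" where
  "prime_filtration M r F P \<longleftrightarrow>
     F 0 = {\<zero>\<^bsub>M\<^esub>} \<and> F r = carrier M \<and>
     (\<forall>i \<le> r. multigraded_submodule (F i) M) \<and>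
     (\<forall>i \<in> {1..r}. F (i - 1) \<subset> F i \<and> multigraded_prime (P i) \<and>
        (\<exists>a. multigraded_iso (quot_mod (restrict_mod M (F i)) (F (i - 1)))
                             (twist (quot_mod S_mod (P i)) a)))"

definition clean :: "(('n::finite, 'k::field) mpoly, 'm, 'n) mgmodule \<Rightarrow> bool" where
  "clean M \<longleftrightarrow> (\<exists>r F P. prime_filtration M r F P \<and> P ` {1..r} = Min_primes M)"

definition pretty_clean :: "(('n::finite, 'k::field) mpoly, 'm, 'n) mgmodule \<Rightarrow> bool" where
  "pretty_clean M \<longleftrightarrow> (\<exists>r F P. prime_filtration M r F P \<and>
     (\<forall>i \<in> {1..r}. \<forall>j \<in> {1..r}. i < j \<and> P i \<subseteq> P j \<longrightarrow> P i = P j))"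

definition almost_clean :: "(('n::finite, 'k::field) mpoly, 'm, 'n) mgmodule \<Rightarrow> bool" where
  "almost_clean M \<longleftrightarrow> (\<exists>r F P. prime_filtration M r F P \<and> P ` {1..r} = Ass M)"


section \<open>Regular sequences\<close>

text \<open>The submodule \<open>(A)M\<close>.\<close>

definition ideal_mult ::
  "('n::finite, 'k::field) mpoly set \<Rightarrow> (('n, 'k) mpoly, 'm, 'n) mgmodule \<Rightarrow> 'm set" where
  "ideal_mult A M =
     \<Inter>{N. submodule N S_ring M \<and> (\<forall>s \<in> A. \<forall>x \<in> carrier M. s \<odot>\<^bsub>M\<^esub> x \<in> N)}"

definition nonzerodivisor_on ::
  "('n::finite, 'k::field) mpoly \<Rightarrow> (('n, 'k) mpoly, 'm, 'n) mgmodule \<Rightarrow> bool" where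
  "nonzerodivisor_on s M \<longleftrightarrow> (\<forall>x \<in> carrier M. s \<odot>\<^bsub>M\<^esub> x = \<zero>\<^bsub>M\<^esub> \<longrightarrow> x = \<zero>\<^bsub>M\<^esub>)"

text \<open>
  The condition \<open>M \<noteq> (u\<^sub>1, \<dots>, u\<^sub>c)M\<close> is part of the notion.
\<close>

definition regular_sequence ::
  "('n::finite, 'k::field) mpoly list \<Rightarrow> (('n, 'k) mpoly, 'm, 'n) mgmodule \<Rightarrow> bool" where
  "regular_sequence us M \<longleftrightarrow>
     (\<forall>i < length us. nonzerodivisor_on (us ! i) (quot_mod M (ideal_mult (set (take i us)) M))) \<and>
     ideal_mult (set us) M \<noteq> carrier M"

end

theory Submission
  imports Defs
begin

text \<open>
  Everything is translated into the combinatorics of exponent vectors. A monomial ideal is spanned by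
  the monomials whose exponents lie in an up-set \<open>E\<close> of \<open>\<nat>\<^sup>n\<close>, and the multigraded
  submodules of \<open>S/I\<close> are the images of the monomial ideals that contain \<open>I\<close>. A factor of a prime
  filtration that is isomorphic to a twist of \<open>S/p\<close> by \<open>m\<close> adds to the up-set exactly the
  exponents \<open>m + \<nat>\<^sup>B\<close>, where \<open>B\<close> is the set of variables outside \<open>p\<close>; such a set is
  called a cell here. A prime filtration of \<open>S/I\<close> is therefore the same as a list of cells which,
  added one after the other, lead from \<open>E\<close> through up-sets to all of \<open>\<nat>\<^sup>n\<close>
  (\<open>cell_chain\<close>; see \<open>prime_filtration_imp_cell_chain\<close> and \<open>cell_chain_imp_prime_filtration\<close>).

  The three notions of cleanness become conditions on the sets \<open>B\<close>, together with \<open>E\<close> in the third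
  case. Pretty cleanness is such a condition by definition. A prime ideal that contains \<open>I\<close> contains
  one of the primes of any given filtration (\<open>cell_chain_prime_contains\<close>), so a filtration is clean
  if and only if its primes form an antichain. Every associated prime occurs in any given filtration
  (\<open>Ass_subset_cell_primes\<close>), so a filtration is almost clean if and only if each of its primes has
  the form \<open>I : x\<^sup>w\<close>.

  By induction it suffices to adjoin one monomial \<open>x\<^sup>u\<close>, with support \<open>T\<close>, that is regular
  on \<open>S/I\<close>. Regularity makes \<open>E\<close> a cylinder in the directions of \<open>T\<close> (\<open>regular_expo_merge\<close>).
  Two operations on chains give the two implications. Slicing fixes the coordinates in \<open>T\<close> to some
  \<open>q\<close> and keeps the cells that meet this slice (\<open>cell_chain_slice\<close>). The product of two chains
  intersects their cells (\<open>cell_chain_prod\<close>).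

  From \<open>E\<close> to \<open>E \<union> (u + \<nat>\<^sup>n)\<close>: a slice at very large coordinates leaves \<open>E\<close>
  unchanged and keeps only cells that are free in all directions of \<open>T\<close>, that is, primes without
  variables of \<open>T\<close>. The product with a chain for the principal ideal of \<open>x\<^sup>u\<close>, whose primes
  are generated by single variables \<open>x\<^sub>j\<close> with \<open>j \<in> T\<close>, replaces each prime \<open>p\<close> by the
  primes \<open>p + (x\<^sub>j)\<close>. Conversely, fix \<open>j \<in> T\<close> and slice a chain of \<open>E \<union> (u +
  \<nat>\<^sup>n)\<close> at \<open>q\<^sub>j = u\<^sub>j - 1\<close> and very large other coordinates. The slice of
  the up-set is again \<open>E\<close>, and every cell that survives has a prime of the form \<open>p + (x\<^sub>j)\<close>,
  which is replaced by \<open>p\<close>. Since \<open>j\<close> is the same for all surviving cells, this changes neither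
  the inclusions between the primes nor their order.
\<close>

section \<open>Up-sets, cells and chains of cells\<close>

abbreviation lookup :: "('a \<Rightarrow>\<^sub>0 'b::zero) \<Rightarrow> 'a \<Rightarrow> 'b" where
  "lookup \<equiv> Poly_Mapping.lookup"

definition expo :: "('n::finite \<Rightarrow> nat) \<Rightarrow> ('n \<Rightarrow>\<^sub>0 nat)" where
  "expo f = Abs_poly_mapping f"

lemma lookup_expo [simp]: "lookup (expo f) i = f i"
  by (simp add: expo_def)

lemma expo_eqI: "(\<And>i. lookup p i = lookup q i) \<Longrightarrow> p = q"
  by (rule poly_mapping_eqI)

definition upset :: "('n::finite \<Rightarrow>\<^sub>0 nat) set \<Rightarrow> bool" where
  "upset E \<longleftrightarrow> (\<forall>p\<in>E. \<forall>q. p + q \<in> E)"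

lemma upsetD: "upset E \<Longrightarrow> p \<in> E \<Longrightarrow> p + q \<in> E"
  by (simp add: upset_def)

text \<open>
  Vectors that are larger in the product order arise by adding a vector of \<open>\<nat>\<^sup>n\<close>.
\<close>

lemma upset_mono:
  assumes "upset E" "p \<in> E" "\<And>i. lookup p i \<le> lookup q i"
  shows "q \<in> E"
proof -
  have "q = p + expo (\<lambda>i. lookup q i - lookup p i)"
    using assms(3) by (intro expo_eqI) (simp add: lookup_add)
  then show ?thesis
    using upsetD[OF assms(1,2)] by metis
qed

text \<open>
  The exponents of the monomials in \<open>x\<^sup>m K[x\<^sub>i | i \<in> B]\<close>, that is, those of a
  twisted copy of \<open>S/(x\<^sub>i | i \<notin> B)\<close>.
\<close>

definition cell :: "('n::finite \<Rightarrow>\<^sub>0 nat) \<Rightarrow> 'n set \<Rightarrow> ('n \<Rightarrow>\<^sub>0 nat) set" where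
  "cell m B = {p. \<forall>i. if i \<in> B then lookup m i \<le> lookup p i else lookup p i = lookup m i}"

lemma mem_cell: "p \<in> cell m B \<longleftrightarrow> (\<forall>i. lookup m i \<le> lookup p i \<and> (i \<notin> B \<longrightarrow> lookup p i = lookup m i))"
  unfolding cell_def by (auto split: if_splits) (metis order_refl)

lemma self_mem_cell [simp]: "m \<in> cell m B"
  by (simp add: mem_cell)

lemma mem_cell_add: "m + p \<in> cell m B \<longleftrightarrow> (\<forall>i. i \<notin> B \<longrightarrow> lookup p i = 0)"
  by (simp add: mem_cell lookup_add)

lemma mem_cell_iff: "p \<in> cell m B \<longleftrightarrow> (\<exists>q. p = m + q \<and> (\<forall>i. i \<notin> B \<longrightarrow> lookup q i = 0))"
proof
  assume p: "p \<in> cell m B"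
  have "p = m + expo (\<lambda>i. lookup p i - lookup m i)"
    using p by (intro expo_eqI) (simp add: lookup_add mem_cell)
  then show "\<exists>q. p = m + q \<and> (\<forall>i. i \<notin> B \<longrightarrow> lookup q i = 0)"
    using p by (metis mem_cell_add)
qed (auto simp: mem_cell lookup_add)

lemma upset_UNIV [simp]: "upset UNIV"
  by (simp add: upset_def)

lemma upset_Un: "upset E \<Longrightarrow> upset F \<Longrightarrow> upset (E \<union> F)"
  by (auto simp: upset_def)

lemma upset_cell_UNIV: "upset (cell m UNIV)"
  by (auto simp: upset_def mem_cell lookup_add trans_le_add1)

text \<open>
  The list is read from the left: each cell is added to the up-set built so far. This is the
  combinatorial shadow of a prime filtration, from the bottom to the top.
\<close>

fun cell_chain :: "('n::finite \<Rightarrow>\<^sub>0 nat) set \<Rightarrow> (('n \<Rightarrow>\<^sub>0 nat) \<times> 'n set) list \<Rightarrow> bool" where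
  "cell_chain E [] \<longleftrightarrow> E = UNIV"
| "cell_chain E ((m, B) # L) \<longleftrightarrow> upset E \<and> cell m B \<inter> E = {} \<and> cell_chain (E \<union> cell m B) L"

lemma cell_chain_upset: "cell_chain E L \<Longrightarrow> upset E"
  by (cases "(E, L)" rule: cell_chain.cases) auto

lemma cell_chain_disjoint: "cell_chain E L \<Longrightarrow> (m, B) \<in> set L \<Longrightarrow> cell m B \<inter> E = {}"
  by (induction E L rule: cell_chain.induct) auto

section \<open>Slices\<close>

definition merge :: "'n set \<Rightarrow> ('n::finite \<Rightarrow>\<^sub>0 nat) \<Rightarrow> ('n \<Rightarrow>\<^sub>0 nat) \<Rightarrow> ('n \<Rightarrow>\<^sub>0 nat)" where
  "merge T q p = expo (\<lambda>i. if i \<in> T then lookup q i else lookup p i)"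

lemma lookup_merge [simp]: "lookup (merge T q p) i = (if i \<in> T then lookup q i else lookup p i)"
  by (simp add: merge_def)

text \<open>
  The slice is extended constantly in the directions of \<open>T\<close>, so that it is again a set of vectors of
  full length.
\<close>

definition slice :: "'n set \<Rightarrow> ('n::finite \<Rightarrow>\<^sub>0 nat) \<Rightarrow> ('n \<Rightarrow>\<^sub>0 nat) set \<Rightarrow> ('n \<Rightarrow>\<^sub>0 nat) set" where
  "slice T q E = {p. merge T q p \<in> E}"

definition meets :: "'n set \<Rightarrow> ('n::finite \<Rightarrow>\<^sub>0 nat) \<Rightarrow> ('n \<Rightarrow>\<^sub>0 nat) \<times> 'n set \<Rightarrow> bool" where
  "meets T q c \<longleftrightarrow> (\<forall>i\<in>T. if i \<in> snd c then lookup (fst c) i \<le> lookup q i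
                          else lookup q i = lookup (fst c) i)"

definition slice_cells ::
  "'n set \<Rightarrow> ('n::finite \<Rightarrow>\<^sub>0 nat) \<Rightarrow> (('n \<Rightarrow>\<^sub>0 nat) \<times> 'n set) list \<Rightarrow> (('n \<Rightarrow>\<^sub>0 nat) \<times> 'n set) list" where
  "slice_cells T q L = map (\<lambda>c. (merge T 0 (fst c), snd c \<union> T)) (filter (meets T q) L)"

lemma upset_slice: "upset E \<Longrightarrow> upset (slice T q E)"
  unfolding slice_def
  by (subst upset_def, clarsimp) (erule (1) upset_mono, simp add: lookup_add)

lemma slice_cell:
  "slice T q (cell m B) = (if meets T q (m, B) then cell (merge T 0 m) (B \<union> T) else {})"
  by (auto simp: slice_def cell_def meets_def split: if_splits)

text \<open>
  Slicing commutes with unions and turns a cell into a cell or into the empty set. The cells that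
  become empty are dropped, and the others still fill the complement in the same order.
\<close>

lemma cell_chain_slice:
  "cell_chain E L \<Longrightarrow> cell_chain (slice T q E) (slice_cells T q L)"
proof (induction E L rule: cell_chain.induct)
  case (1 E)
  then show ?case by (simp add: slice_cells_def slice_def)
next
  case (2 E m B L)
  have un: "slice T q (E \<union> cell m B) = slice T q E \<union> slice T q (cell m B)"
    and disj: "slice T q (cell m B) \<inter> slice T q E = {}"
    using 2(2) by (auto simp: slice_def)
  show ?case
  proof (cases "meets T q (m, B)")
    case True
    then have c: "slice T q (cell m B) = cell (merge T 0 m) (B \<union> T)"
      by (simp add: slice_cell)
    have L: "slice_cells T q ((m, B) # L) = (merge T 0 m, B \<union> T) # slice_cells T q L"
      using True by (simp add: slice_cells_def)
    show ?thesis
      using 2 un disj upset_slice[of E T q] unfolding c L by simp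
  next
    case False
    then have "slice T q (cell m B) = {}" "slice_cells T q ((m, B) # L) = slice_cells T q L"
      by (simp_all add: slice_cell slice_cells_def)
    then show ?thesis using 2 un by simp
  qed
qed

section \<open>Products of chains\<close>

text \<open>
  For transversal cells, these are their intersections, sorted first by the cell on the left.
\<close>

definition prod_cells ::
  "(('n::finite \<Rightarrow>\<^sub>0 nat) \<times> 'n set) list \<Rightarrow> (('n \<Rightarrow>\<^sub>0 nat) \<times> 'n set) list \<Rightarrow> (('n \<Rightarrow>\<^sub>0 nat) \<times> 'n set) list" where
  "prod_cells L W = concat (map (\<lambda>(m, B). map (\<lambda>(w, D). (m + w, B \<inter> D)) W) L)"

text \<open>
  One cell of the left factor is cut into pieces along the chain of \<open>V\<close>. The additional up-set
  \<open>V0\<close>, contained in all stages of that chain, is what makes the induction possible: it stands for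
  the initial \<open>V\<close>, while \<open>V\<close> itself grows.
\<close>

lemma cell_chain_refine_step:
  assumes "cell_chain V W" "upset E" "upset V0" "V0 \<subseteq> V" "cell m B \<inter> E = {}"
    "cell_chain (E \<union> cell m B \<union> V0) Z" "upset (E \<union> cell m B)"
    "\<And>w D. (w, D) \<in> set W \<Longrightarrow> cell m B \<inter> cell w D = cell (m + w) (B \<inter> D)"
  shows "cell_chain (E \<union> V0 \<union> (cell m B \<inter> V)) (map (\<lambda>(w, D). (m + w, B \<inter> D)) W @ Z)"
  using assms
proof (induction V W rule: cell_chain.induct)
  case (1 V)
  then show ?case by (simp add: Un_ac)
next
  case (2 V w D W)
  have cell: "cell m B \<inter> cell w D = cell (m + w) (B \<inter> D)"
    using 2(9) by simp
  have "E \<union> V0 \<union> (cell m B \<inter> V) = E \<union> V0 \<union> ((E \<union> cell m B) \<inter> V)"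
    by blast
  moreover have "upset ((E \<union> cell m B) \<inter> V)"
    using 2(2) \<open>upset (E \<union> cell m B)\<close> by (auto simp: upset_def)
  ultimately have up: "upset (E \<union> V0 \<union> (cell m B \<inter> V))"
    using 2 by (simp add: upset_Un)
  have disj: "cell (m + w) (B \<inter> D) \<inter> (E \<union> V0 \<union> (cell m B \<inter> V)) = {}"
  proof -
    have "cell w D \<inter> V = {}" "V0 \<subseteq> V" "cell m B \<inter> E = {}" using 2 by auto
    then show ?thesis unfolding cell[symmetric] by blast
  qed
  have eq: "E \<union> V0 \<union> (cell m B \<inter> V) \<union> cell (m + w) (B \<inter> D)
      = E \<union> V0 \<union> (cell m B \<inter> (V \<union> cell w D))"
    unfolding cell[symmetric] by blast
  have "cell_chain (E \<union> V0 \<union> (cell m B \<inter> (V \<union> cell w D)))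
      (map (\<lambda>(w, D). (m + w, B \<inter> D)) W @ Z)"
    using 2 by (intro 2(1)) auto
  then show ?case
    using up disj eq by simp
qed

text \<open>
  The assumption on the intersections says that the two families of cells are transversal. The left
  chain gives a coarse decomposition of the complement of \<open>E\<close>, and each of its cells is refined by
  the right chain, which starts at \<open>V\<close>.
\<close>

lemma cell_chain_prod:
  assumes "cell_chain E L" "cell_chain V W"
    and "\<And>m B w D. (m, B) \<in> set L \<Longrightarrow> (w, D) \<in> set W \<Longrightarrow>
      cell m B \<inter> cell w D = cell (m + w) (B \<inter> D)"
  shows "cell_chain (E \<union> V) (prod_cells L W)"
  using assms
proof (induction E L rule: cell_chain.induct)
  case (1 E)
  then show ?case by (simp add: prod_cells_def)
next
  case (2 E m B L)
  have "cell_chain (E \<union> cell m B \<union> V) (prod_cells L W)"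
    using 2 by auto
  moreover have "upset (E \<union> cell m B)" "upset V"
    using 2 cell_chain_upset by auto
  ultimately have "cell_chain (E \<union> V \<union> (cell m B \<inter> V)) (map (\<lambda>(w, D). (m + w, B \<inter> D)) W @ prod_cells L W)"
    using 2 by (intro cell_chain_refine_step) auto
  moreover have "E \<union> V \<union> (cell m B \<inter> V) = E \<union> V" by blast
  ultimately show ?case by (simp add: prod_cells_def)
qed

abbreviation unit_expo :: "'n::finite \<Rightarrow> ('n \<Rightarrow>\<^sub>0 nat)" where
  "unit_expo j \<equiv> Poly_Mapping.single j (Suc 0)"

lemma expo_induct [case_names zero add]:
  fixes u :: "'n::finite \<Rightarrow>\<^sub>0 nat"
  assumes "P 0" "\<And>u j. P u \<Longrightarrow> P (u + unit_expo j)"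
  shows "P u"
proof (induction "\<Sum>i\<in>UNIV. lookup u i" arbitrary: u)
  case 0
  then have "u = 0" by (intro expo_eqI) simp
  then show ?case using assms(1) by simp
next
  case (Suc k)
  then obtain j where j: "lookup u j \<noteq> 0"
    by (metis Zero_not_Suc sum.neutral)
  define v where "v = u - unit_expo j"
  have u: "u = v + unit_expo j"
    using j by (intro expo_eqI) (auto simp: v_def lookup_add lookup_minus lookup_single when_def)
  have "(\<Sum>i\<in>UNIV. lookup u i) = (\<Sum>i\<in>UNIV. lookup v i) + 1"
    by (simp add: u lookup_add lookup_single sum.distrib when_def)
  then show ?case
    using Suc assms(2)[of v j] by (simp add: u)
qed

text \<open>
  A filtration of \<open>S/(x\<^sup>u)\<close> is obtained by dividing by one variable at a time: if \<open>u = v +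
  e\<^sub>j\<close> then \<open>(x\<^sup>v)/(x\<^sup>u)\<close> is a twist of \<open>S/(x\<^sub>j)\<close>.
\<close>

lemma principal_chain:
  fixes u :: "'n::finite \<Rightarrow>\<^sub>0 nat"
  shows "\<exists>W. cell_chain (cell u UNIV) W \<and>
    (\<forall>(w, D) \<in> set W. (\<forall>i. lookup w i \<le> lookup u i) \<and> (\<exists>j. lookup u j > 0 \<and> D = - {j}))"
proof (induction u rule: expo_induct)
  case zero
  have "cell (0 :: 'n \<Rightarrow>\<^sub>0 nat) UNIV = UNIV" by (auto simp: mem_cell)
  then show ?case by (intro exI[of _ "[]"]) simp
next
  case (add u j)
  then obtain W where W: "cell_chain (cell u UNIV) W"
    "\<forall>(w, D) \<in> set W. (\<forall>i. lookup w i \<le> lookup u i) \<and> (\<exists>j. lookup u j > 0 \<and> D = - {j})"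
    by blast
  have lk: "lookup (u + unit_expo j) i = lookup u i + (if i = j then 1 else 0)" for i
    by (auto simp: lookup_add lookup_single when_def)
  have "p \<in> cell (u + unit_expo j) UNIV \<union> cell u (- {j}) \<longleftrightarrow> p \<in> cell u UNIV" for p
  proof (cases "lookup p j = lookup u j")
    case True
    then have "p \<notin> cell (u + unit_expo j) UNIV"
      unfolding mem_cell lk by (auto intro!: exI[of _ j])
    then show ?thesis using True by (auto simp: mem_cell)
  next
    case False
    then have "lookup u i + (if i = j then 1 else 0) \<le> lookup p i \<longleftrightarrow> lookup u i \<le> lookup p i" for i
      by auto
    then show ?thesis using False by (auto simp: mem_cell lk)
  qed
  then have "cell (u + unit_expo j) UNIV \<union> cell u (- {j}) = cell u UNIV"
    by blast
  moreover have "cell u (- {j}) \<inter> cell (u + unit_expo j) UNIV = {}"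
    by (auto simp: mem_cell lk) (metis (full_types) Suc_n_not_le_n Suc_eq_plus1)
  ultimately have "cell_chain (cell (u + unit_expo j) UNIV) ((u, - {j}) # W)"
    using W(1) by (simp add: upset_cell_UNIV)
  moreover have "\<forall>(w, D) \<in> set ((u, - {j}) # W). (\<forall>i. lookup w i \<le> lookup (u + unit_expo j) i) \<and>
      (\<exists>k. lookup (u + unit_expo j) k > 0 \<and> D = - {k})"
  proof (clarify, intro conjI)
    fix w D assume wD: "(w, D) \<in> set ((u, - {j}) # W)"
    show "\<forall>i. lookup w i \<le> lookup (u + unit_expo j) i"
      using wD W(2) by (fastforce simp: lk intro: trans_le_add1 le_SucI)
    show "\<exists>k. lookup (u + unit_expo j) k > 0 \<and> D = - {k}"
      using wD W(2) by (fastforce simp: lk)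
  qed
  ultimately show ?case by blast
qed


section \<open>Adjoining a regular monomial\<close>

text \<open>
  This says that the monomial \<open>x\<^sup>u\<close> is a nonzerodivisor modulo the monomial ideal of \<open>E\<close>.
\<close>

definition regular_expo :: "('n::finite \<Rightarrow>\<^sub>0 nat) \<Rightarrow> ('n \<Rightarrow>\<^sub>0 nat) set \<Rightarrow> bool" where
  "regular_expo u E \<longleftrightarrow> (\<forall>p. u + p \<in> E \<longrightarrow> p \<in> E)"

definition supp :: "('n::finite \<Rightarrow>\<^sub>0 nat) \<Rightarrow> 'n set" where
  "supp u = {i. lookup u i > 0}"

text \<open>
  Membership in \<open>E\<close> does not depend on the coordinates in the support of \<open>u\<close>: these coordinates
  can be raised beyond any bound by adding multiples of \<open>u\<close>, and regularity removes the multiples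
  again.
\<close>

lemma regular_expo_merge:
  assumes "upset E" "regular_expo u E"
  shows "merge (supp u) q p \<in> E \<longleftrightarrow> p \<in> E"
proof -
  have "q \<in> E" if p: "p \<in> E" and pq: "\<And>i. i \<notin> supp u \<Longrightarrow> lookup p i = lookup q i" for p q
  proof -
    have iter: "q \<in> E" if "expo (\<lambda>i. k * lookup u i) + q \<in> E" for k
      using that
    proof (induction k)
      case 0
      have "expo (\<lambda>i. 0 * lookup u i) + q = q" by (intro expo_eqI) (simp add: lookup_add)
      with 0 show ?case by simp
    next
      case (Suc k)
      have "expo (\<lambda>i. Suc k * lookup u i) + q = u + (expo (\<lambda>i. k * lookup u i) + q)"
        by (intro expo_eqI) (simp add: lookup_add)
      then show ?case using Suc assms(2) by (simp add: regular_expo_def)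
    qed
    define k where "k = (\<Sum>i\<in>UNIV. lookup p i)"
    have "lookup p i \<le> k * lookup u i + lookup q i" for i
    proof (cases "i \<in> supp u")
      case True
      have "lookup p i \<le> k" unfolding k_def by (rule member_le_sum) auto
      also have "k \<le> k * lookup u i" using True by (simp add: supp_def)
      finally show ?thesis by simp
    qed (use pq in simp)
    then have "expo (\<lambda>i. k * lookup u i) + q \<in> E"
      by (intro upset_mono[OF assms(1) p]) (simp add: lookup_add)
    then show "q \<in> E" by (rule iter)
  qed
  from this[of p "merge (supp u) q p"] this[of "merge (supp u) q p" p] show ?thesis
    by auto
qed

text \<open>
  For the monomial ideal \<open>I\<close> of \<open>E\<close> and some monomial \<open>x\<^sup>w\<close>, this is the equation \<open>I :
  x\<^sup>w = (x\<^sub>j | j \<notin> B)\<close> on the level of monomials.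
\<close>

definition colon_prime :: "('n::finite \<Rightarrow>\<^sub>0 nat) set \<Rightarrow> 'n set \<Rightarrow> bool" where
  "colon_prime E B \<longleftrightarrow> (\<exists>w. \<forall>p. w + p \<in> E \<longleftrightarrow> (\<exists>j. j \<notin> B \<and> lookup p j > 0))"

definition clean_cells :: "'n set list \<Rightarrow> bool" where
  "clean_cells Bs \<longleftrightarrow> (\<forall>B\<in>set Bs. \<forall>C\<in>set Bs. B \<subseteq> C \<longrightarrow> B = C)"

text \<open>
  Inclusions are reversed when primes are replaced by their sets of free variables.
\<close>

definition pretty_clean_cells :: "'n set list \<Rightarrow> bool" where
  "pretty_clean_cells Bs \<longleftrightarrow> sorted_wrt (\<lambda>B C. C \<subseteq> B \<longrightarrow> B = C) Bs"

definition almost_clean_cells :: "('n::finite \<Rightarrow>\<^sub>0 nat) set \<Rightarrow> 'n set list \<Rightarrow> bool" where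
  "almost_clean_cells E Bs \<longleftrightarrow> (\<forall>B\<in>set Bs. colon_prime E B)"

text \<open>
  The slice lies above the corners of all cells, hence it only meets cells that are free in all
  directions of the support of \<open>u\<close>. Since \<open>E\<close> is a cylinder in these directions, the slice is
  \<open>E\<close> again.
\<close>

lemma large_slice:
  fixes E :: "('n::finite \<Rightarrow>\<^sub>0 nat) set"
  assumes "cell_chain E L" "regular_expo u E"
  obtains L' where "cell_chain E L'"
    "\<And>m B. (m, B) \<in> set L' \<Longrightarrow> supp u \<subseteq> B \<and> (\<forall>i\<in>supp u. lookup m i = 0)"
    "\<exists>Q. map snd L' = filter Q (map snd L)"
proof -
  let ?T = "supp u"
  define q :: "'n \<Rightarrow>\<^sub>0 nat" where "q = expo (\<lambda>i. Suc (\<Sum>c\<leftarrow>L. lookup (fst c) i))"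
  have large: "lookup (fst c) i < lookup q i" if "c \<in> set L" for c i
    using member_le_sum_list[of "lookup (fst c) i" "map (\<lambda>c. lookup (fst c) i) L"] that
    by (auto simp: q_def less_Suc_eq_le)
  have meets: "meets ?T q c \<longleftrightarrow> ?T \<subseteq> snd c" if "c \<in> set L" for c
  proof -
    have "lookup (fst c) i \<le> lookup q i" "lookup q i \<noteq> lookup (fst c) i" for i
      using large[OF that, of i] by auto
    then show ?thesis by (auto simp: meets_def)
  qed
  have "slice ?T q E = E"
    using regular_expo_merge[OF cell_chain_upset[OF assms(1)] assms(2)] by (simp add: slice_def)
  with cell_chain_slice[OF assms(1), of ?T q] have "cell_chain E (slice_cells ?T q L)"
    by simp
  moreover have "slice_cells ?T q L = map (\<lambda>c. (merge ?T 0 (fst c), snd c)) (filter (\<lambda>c. ?T \<subseteq> snd c) L)"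
    unfolding slice_cells_def using meets by (auto intro!: map_cong filter_cong)
  moreover have "map snd (map (\<lambda>c. (merge ?T 0 (fst c), snd c)) (filter (\<lambda>c. ?T \<subseteq> snd c) L))
      = filter (\<lambda>B. ?T \<subseteq> B) (map snd L)"
    by (simp add: filter_map o_def)
  ultimately show thesis
    by (intro that[of "slice_cells ?T q L"]) auto
qed

text \<open>
  Each prime \<open>p\<close> of the (sliced) chain gives rise to the primes \<open>p + (x\<^sub>j)\<close> with \<open>j\<close> in
  the support of \<open>u\<close>. An inclusion between two of these forces the variables \<open>x\<^sub>j\<close> to agree
  and restricts to an inclusion of the original primes.
\<close>

lemma cell_chain_adjoin:
  fixes E :: "('n::finite \<Rightarrow>\<^sub>0 nat) set"
  assumes "cell_chain E L" "regular_expo u E"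
  obtains L' where "cell_chain (E \<union> cell u UNIV) L'"
    "clean_cells (map snd L) \<Longrightarrow> clean_cells (map snd L')"
    "pretty_clean_cells (map snd L) \<Longrightarrow> pretty_clean_cells (map snd L')"
    "almost_clean_cells E (map snd L) \<Longrightarrow> almost_clean_cells (E \<union> cell u UNIV) (map snd L')"
proof -
  let ?T = "supp u"
  obtain L1 where L1: "cell_chain E L1"
    "\<And>m B. (m, B) \<in> set L1 \<Longrightarrow> ?T \<subseteq> B \<and> (\<forall>i\<in>?T. lookup m i = 0)"
    "\<exists>Q. map snd L1 = filter Q (map snd L)"
    using large_slice[OF assms] by blast
  obtain W where W: "cell_chain (cell u UNIV) W"
    "\<And>w D. (w, D) \<in> set W \<Longrightarrow> (\<forall>i. lookup w i \<le> lookup u i) \<and> (\<exists>j\<in>?T. D = - {j})"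
    using principal_chain[of u] unfolding supp_def by fast
  have cells: "cell m B \<inter> cell w D = cell (m + w) (B \<inter> D)"
    if mB: "(m, B) \<in> set L1" and wD: "(w, D) \<in> set W" for m B w D
  proof -
    obtain j where j: "j \<in> ?T" "D = - {j}" using W(2)[OF wD] by blast
    have T: "i \<in> B" "lookup m i = 0" if "i \<in> ?T" for i
      using L1(2)[OF mB] that by auto
    have nT: "lookup w i = 0" if "i \<notin> ?T" for i
      using W(2)[OF wD] that by (auto simp: supp_def) (metis le_zero_eq)
    have "p \<in> cell m B \<and> p \<in> cell w D \<longleftrightarrow> p \<in> cell (m + w) (B \<inter> D)" for p
    proof -
      have "(lookup m i \<le> lookup p i \<and> (i \<notin> B \<longrightarrow> lookup p i = lookup m i)) \<and>
          (lookup w i \<le> lookup p i \<and> (i \<notin> D \<longrightarrow> lookup p i = lookup w i)) \<longleftrightarrow>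
          lookup (m + w) i \<le> lookup p i \<and> (i \<notin> B \<inter> D \<longrightarrow> lookup p i = lookup (m + w) i)" for i
        using T[of i] nT[of i] j by (cases "i \<in> ?T") (auto simp: lookup_add)
      then show ?thesis unfolding mem_cell by blast
    qed
    then show ?thesis by blast
  qed
  let ?L = "prod_cells L1 W"
  have mem: "\<exists>B j. B \<in> set (map snd L) \<and> ?T \<subseteq> B \<and> j \<in> ?T \<and> C = B - {j}" if C: "C \<in> set (map snd ?L)" for C
  proof -
    from C obtain m B w D where mB: "(m, B) \<in> set L1" and wD: "(w, D) \<in> set W" and C: "C = B \<inter> D"
      by (auto simp: prod_cells_def)
    obtain j where "j \<in> ?T" "D = - {j}" using W(2)[OF wD] by blast
    moreover have "?T \<subseteq> B" using L1(2)[OF mB] by blast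
    moreover have "B \<in> set (map snd L1)" using mB by force
    then have "B \<in> set (map snd L)" using L1(3) by (metis filter_is_subset subsetD)
    ultimately show ?thesis using C by (intro exI[of _ B] exI[of _ j]) auto
  qed
  show thesis
  proof (rule that)
    show "cell_chain (E \<union> cell u UNIV) ?L"
      by (rule cell_chain_prod[OF L1(1) W(1) cells])
  next
    assume cl: "clean_cells (map snd L)"
    show "clean_cells (map snd ?L)"
      unfolding clean_cells_def
    proof (intro ballI impI)
      fix C C' assume "C \<in> set (map snd ?L)" "C' \<in> set (map snd ?L)" and sub: "C \<subseteq> C'"
      then obtain B j B' j' where
        B: "B \<in> set (map snd L)" "?T \<subseteq> B" "j \<in> ?T" "C = B - {j}" and
        B': "B' \<in> set (map snd L)" "?T \<subseteq> B'" "j' \<in> ?T" "C' = B' - {j'}"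
        using mem by meson
      have "j = j'" "B \<subseteq> B'" using sub B B' by blast+
      then show "C = C'" using cl B B' unfolding clean_cells_def by blast
    qed
  next
    assume "pretty_clean_cells (map snd L)"
    then have "pretty_clean_cells (map snd L1)"
      using L1(3) by (auto simp: pretty_clean_cells_def sorted_wrt_filter)
    then have sorted: "sorted_wrt (\<lambda>c d. snd d \<subseteq> snd c \<longrightarrow> snd c = snd d) L1"
      by (simp add: pretty_clean_cells_def sorted_wrt_map)
    have "sorted_wrt (\<lambda>c d. snd d \<subseteq> snd c \<longrightarrow> snd c = snd d) (prod_cells K W)"
      if "set K \<subseteq> set L1" "sorted_wrt (\<lambda>c d. snd d \<subseteq> snd c \<longrightarrow> snd c = snd d) K" for K
      using that
    proof (induction K)
      case Nil
      then show ?case by (simp add: prod_cells_def)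
    next
      case (Cons c K)
      obtain m B where c: "c = (m, B)" by force
      have cut: "B \<inter> D = C \<inter> D'" if hyps: "C \<inter> D' \<subseteq> B \<inter> D" "(n, C) \<in> set (c # K)"
        "(w, D) \<in> set W" "(w', D') \<in> set W" for n C w D w' D'
      proof -
        obtain j j' where "j \<in> ?T" "D = - {j}" "j' \<in> ?T" "D' = - {j'}"
          using W(2)[OF hyps(3)] W(2)[OF hyps(4)] by blast
        moreover have "?T \<subseteq> B" "?T \<subseteq> C" using L1(2) Cons(2) hyps(2) c by auto
        ultimately have "j = j'" "C \<subseteq> B" "D = D'" using hyps(1) by blast+
        moreover have "C \<subseteq> B \<longrightarrow> B = C" using hyps(2) Cons(3) c by fastforce
        ultimately show ?thesis by simp
      qed
      have "sorted_wrt (\<lambda>c d. snd d \<subseteq> snd c \<longrightarrow> snd c = snd d) (map (\<lambda>(w, D). (m + w, B \<inter> D)) W)"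
        unfolding sorted_wrt_iff_nth_less
      proof (intro allI impI)
        fix k l assume kl: "k < l" "l < length (map (\<lambda>(w, D). (m + w, B \<inter> D)) W)"
        obtain w D w' D' where "W ! k = (w, D)" "W ! l = (w', D')" by fastforce
        moreover from this have "(w, D) \<in> set W" "(w', D') \<in> set W"
          using kl by (metis length_map nth_mem order.strict_trans)+
        moreover assume "snd (map (\<lambda>(w, D). (m + w, B \<inter> D)) W ! l) \<subseteq> snd (map (\<lambda>(w, D). (m + w, B \<inter> D)) W ! k)"
        ultimately show "snd (map (\<lambda>(w, D). (m + w, B \<inter> D)) W ! k) = snd (map (\<lambda>(w, D). (m + w, B \<inter> D)) W ! l)"
          using kl c cut[of B D' D m w w'] by simp
      qed
      moreover have "snd c' = snd d" if c': "c' \<in> set (map (\<lambda>(w, D). (m + w, B \<inter> D)) W)"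
        and d: "d \<in> set (prod_cells K W)" and sub: "snd d \<subseteq> snd c'" for c' d
      proof -
        from c' obtain w D where "(w, D) \<in> set W" "c' = (m + w, B \<inter> D)" by auto
        moreover from d obtain n C w' D' where "(n, C) \<in> set K" "(w', D') \<in> set W" "d = (n + w', C \<inter> D')"
          by (auto simp: prod_cells_def)
        ultimately show ?thesis using cut[of C D' D n w w'] sub by simp
      qed
      moreover have "sorted_wrt (\<lambda>c d. snd d \<subseteq> snd c \<longrightarrow> snd c = snd d) (prod_cells K W)"
        using Cons by simp
      moreover have "prod_cells (c # K) W = map (\<lambda>(w, D). (m + w, B \<inter> D)) W @ prod_cells K W"
        by (simp add: prod_cells_def c)
      ultimately show ?case
        by (simp only: sorted_wrt_append) blast
    qed
    then show "pretty_clean_cells (map snd ?L)"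
      using sorted by (simp add: pretty_clean_cells_def sorted_wrt_map)
  next
    assume ac: "almost_clean_cells E (map snd L)"
    show "almost_clean_cells (E \<union> cell u UNIV) (map snd ?L)"
      unfolding almost_clean_cells_def
    proof
      fix C assume "C \<in> set (map snd ?L)"
      then obtain B j where B: "B \<in> set (map snd L)" "?T \<subseteq> B" "j \<in> ?T" "C = B - {j}"
        using mem by meson
      have "colon_prime E B"
        using ac B(1) unfolding almost_clean_cells_def by blast
      then obtain w where w: "\<And>p. w + p \<in> E \<longleftrightarrow> (\<exists>j. j \<notin> B \<and> lookup p j > 0)"
        unfolding colon_prime_def by blast
      \<comment> \<open>On the support of \<open>u\<close>, this is \<open>u\<close> divided by \<open>x\<^sub>j\<close>: multiplying by a monomial then
        gives a multiple of \<open>x\<^sup>u\<close> precisely when that monomial is divisible by \<open>x\<^sub>j\<close>.\<close>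
      define v where "v = merge ?T (u - unit_expo j) w"
      have "v + p \<in> E \<union> cell u UNIV \<longleftrightarrow> (\<exists>l. l \<notin> C \<and> lookup p l > 0)" for p
      proof -
        note mrg = regular_expo_merge[OF cell_chain_upset[OF assms(1)] assms(2), symmetric]
        have "merge ?T 0 (v + p) = merge ?T 0 (w + p)"
          by (intro expo_eqI) (auto simp: v_def lookup_add)
        then have "v + p \<in> E \<longleftrightarrow> w + p \<in> E"
          using mrg[of "v + p" 0] mrg[of "w + p" 0] by simp
        moreover have "v + p \<in> cell u UNIV \<longleftrightarrow> lookup p j > 0"
        proof -
          have "lookup u i \<le> lookup (v + p) i \<longleftrightarrow> (i = j \<longrightarrow> lookup p j > 0)" for i
            using B(3) by (auto simp: v_def lookup_add lookup_minus lookup_single when_def supp_def)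
          then show ?thesis by (auto simp: mem_cell)
        qed
        ultimately show ?thesis unfolding Un_iff w B(4) by auto
      qed
      then show "colon_prime (E \<union> cell u UNIV) C"
        unfolding colon_prime_def by blast
    qed
  qed
qed


text \<open>
  The slice just below the hyperplane \<open>x\<^sub>j = u\<^sub>j\<close> misses all multiples of \<open>x\<^sup>u\<close>.
  A cell that meets it cannot be free in the direction \<open>j\<close>, for otherwise, being free in the
  remaining directions of the support of \<open>u\<close>, it would contain a multiple of \<open>x\<^sup>u\<close>. So all
  surviving primes contain the same single variable from the support.
\<close>

lemma cell_chain_descend:
  fixes E :: "('n::finite \<Rightarrow>\<^sub>0 nat) set"
  assumes E: "upset E" "regular_expo u E" and "u \<noteq> 0"
    and chain: "cell_chain (E \<union> cell u UNIV) L"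
  obtains L' where "cell_chain E L'"
    "clean_cells (map snd L) \<Longrightarrow> clean_cells (map snd L')"
    "pretty_clean_cells (map snd L) \<Longrightarrow> pretty_clean_cells (map snd L')"
    "almost_clean_cells (E \<union> cell u UNIV) (map snd L) \<Longrightarrow> almost_clean_cells E (map snd L')"
proof -
  let ?T = "supp u" and ?E' = "E \<union> cell u UNIV"
  obtain j where j: "j \<in> ?T"
    using \<open>u \<noteq> 0\<close> by (metis expo_eqI lookup_zero mem_Collect_eq not_gr_zero supp_def)
  \<comment> \<open>The successor of the sum exceeds every corner coordinate, so the equation demanded by meeting fails
    in bound directions other than \<open>j\<close>.\<close>
  define q :: "'n \<Rightarrow>\<^sub>0 nat" where
    "q = expo (\<lambda>i. if i = j then lookup u j - 1 else Suc (\<Sum>c\<leftarrow>L. lookup (fst c) i))"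
  have large: "lookup (fst c) i < lookup q i" if "c \<in> set L" "i \<noteq> j" for c i
    using member_le_sum_list[of "lookup (fst c) i" "map (\<lambda>c. lookup (fst c) i) L"] that
    by (auto simp: q_def less_Suc_eq_le)
  have meets: "?T - {j} \<subseteq> B \<and> j \<notin> B" if mB: "(m, B) \<in> set L" and "meets ?T q (m, B)" for m B
  proof -
    have sub: "?T - {j} \<subseteq> B"
    proof
      fix i assume "i \<in> ?T - {j}"
      then show "i \<in> B"
        using that(2) large[OF mB, of i] by (auto simp: meets_def split: if_splits)
    qed
    have "j \<notin> B"
    proof
      assume "j \<in> B"
      with sub have "?T \<subseteq> B" by blast
      then have "m + u \<in> cell m B"
        by (auto simp: mem_cell_add supp_def)
      moreover have "m + u \<in> cell u UNIV"
        by (simp add: mem_cell lookup_add)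
      ultimately show False
        using cell_chain_disjoint[OF chain mB] by blast
    qed
    with sub show ?thesis by blast
  qed
  let ?L = "slice_cells ?T q L"
  have "merge ?T q p \<notin> cell u UNIV" for p
    using j by (auto simp: mem_cell supp_def q_def intro!: exI[of _ j])
  then have "slice ?T q ?E' = E"
    using regular_expo_merge[OF E] by (auto simp: slice_def)
  with cell_chain_slice[OF chain, of ?T q] have L: "cell_chain E ?L"
    by simp
  have snd: "map snd ?L = map (\<lambda>B. B \<union> ?T) (map snd (filter (meets ?T q) L))"
    by (simp add: slice_cells_def)
  have inj: "B \<union> ?T \<subseteq> C \<union> ?T \<longleftrightarrow> B \<subseteq> C"
    if "B \<in> set (map snd (filter (meets ?T q) L))" "C \<in> set (map snd (filter (meets ?T q) L))" for B C
  proof -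
    have "?T - {j} \<subseteq> B \<and> j \<notin> B" "?T - {j} \<subseteq> C \<and> j \<notin> C"
      using that meets by fastforce+
    then show ?thesis by blast
  qed
  show thesis
  proof (rule that[OF L])
    assume cl: "clean_cells (map snd L)"
    show "clean_cells (map snd ?L)"
      unfolding snd clean_cells_def
    proof (intro ballI impI)
      fix B' C' assume "B' \<in> set (map (\<lambda>B. B \<union> ?T) (map snd (filter (meets ?T q) L)))"
        "C' \<in> set (map (\<lambda>B. B \<union> ?T) (map snd (filter (meets ?T q) L)))" "B' \<subseteq> C'"
      then obtain B C where *: "B \<in> set (map snd (filter (meets ?T q) L))" "B' = B \<union> ?T"
        "C \<in> set (map snd (filter (meets ?T q) L))" "C' = C \<union> ?T"
        unfolding set_map[of "\<lambda>B. B \<union> ?T"] by blast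
      then have "B \<subseteq> C" using inj \<open>B' \<subseteq> C'\<close> by blast
      moreover have "B \<in> set (map snd L)" "C \<in> set (map snd L)" using * by auto
      ultimately show "B' = C'" using cl * unfolding clean_cells_def by blast
    qed
  next
    assume "pretty_clean_cells (map snd L)"
    then have "sorted_wrt (\<lambda>c d. snd d \<subseteq> snd c \<longrightarrow> snd c = snd d) (filter (meets ?T q) L)"
      by (simp add: pretty_clean_cells_def sorted_wrt_map sorted_wrt_filter)
    then have "sorted_wrt (\<lambda>c d. snd d \<union> ?T \<subseteq> snd c \<union> ?T \<longrightarrow> snd c \<union> ?T = snd d \<union> ?T) (filter (meets ?T q) L)"
      by (rule sorted_wrt_mono_rel[rotated]) (use inj in auto)
    then show "pretty_clean_cells (map snd ?L)"
      unfolding snd by (simp add: pretty_clean_cells_def sorted_wrt_map)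
  next
    assume ac: "almost_clean_cells ?E' (map snd L)"
    show "almost_clean_cells E (map snd ?L)"
      unfolding almost_clean_cells_def
    proof
      fix C assume "C \<in> set (map snd ?L)"
      then obtain m B where mB: "(m, B) \<in> set L" "meets ?T q (m, B)" and C: "C = B \<union> ?T"
        unfolding snd by force
      have "B \<in> set (map snd L)"
        using mB(1) by force
      then have "colon_prime ?E' B"
        using ac unfolding almost_clean_cells_def by blast
      then obtain w where w: "\<And>p. w + p \<in> ?E' \<longleftrightarrow> (\<exists>j. j \<notin> B \<and> lookup p j > 0)"
        unfolding colon_prime_def by blast
      have "w + p \<in> E \<longleftrightarrow> (\<exists>l. l \<notin> C \<and> lookup p l > 0)" for p
      proof -
        define p0 where "p0 = merge ?T 0 p"
        have "merge ?T 0 (w + p) = merge ?T 0 (w + p0)"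
          by (intro expo_eqI) (auto simp: p0_def lookup_add)
        then have "w + p \<in> E \<longleftrightarrow> w + p0 \<in> E"
          using regular_expo_merge[OF E, symmetric, of "w + p" 0]
            regular_expo_merge[OF E, symmetric, of "w + p0" 0] by simp
        moreover have "w + p0 \<notin> cell u UNIV"
        proof -
          have "w \<notin> cell u UNIV" using w[of 0] by simp
          then obtain i where "lookup w i < lookup u i" by (auto simp: mem_cell not_le)
          then have "lookup (w + p0) i < lookup u i" by (auto simp: lookup_add p0_def supp_def)
          then show ?thesis by (auto simp: mem_cell not_le)
        qed
        ultimately have "w + p \<in> E \<longleftrightarrow> (\<exists>l. l \<notin> B \<and> lookup p0 l > 0)"
          using w[of p0] by blast
        then show ?thesis by (auto simp: p0_def C)
      qed
      then show "colon_prime E C"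
        unfolding colon_prime_def by blast
    qed
  qed
qed

section \<open>Monomial ideals as spans of exponent sets\<close>

abbreviation keys :: "('a \<Rightarrow>\<^sub>0 'b::zero) \<Rightarrow> 'a set" where
  "keys \<equiv> Poly_Mapping.keys"

abbreviation mon :: "('n::finite \<Rightarrow>\<^sub>0 nat) \<Rightarrow> ('n, 'k::field) mpoly" where
  "mon m \<equiv> Poly_Mapping.single m 1"

lemma S_ring_simps [simp]:
  "carrier S_ring = UNIV" "x \<oplus>\<^bsub>S_ring\<^esub> y = x + y" "x \<otimes>\<^bsub>S_ring\<^esub> y = x * y"
  "\<zero>\<^bsub>S_ring\<^esub> = 0" "\<one>\<^bsub>S_ring\<^esub> = 1"
  by (simp_all add: ring_of_type_algebra_def)

lemma S_ring_cring: "cring (S_ring :: ('n::finite, 'k::field) mpoly ring)"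
  by (rule cring_from_type_algebra)

definition is_ideal :: "('n::finite, 'k::field) mpoly set \<Rightarrow> bool" where
  "is_ideal J \<longleftrightarrow> 0 \<in> J \<and> (\<forall>f\<in>J. \<forall>g\<in>J. f + g \<in> J) \<and> (\<forall>s. \<forall>f\<in>J. s * f \<in> J)"

lemma is_idealD:
  assumes "is_ideal J"
  shows "0 \<in> J" "f \<in> J \<Longrightarrow> g \<in> J \<Longrightarrow> f + g \<in> J" "f \<in> J \<Longrightarrow> s * f \<in> J"
    "f \<in> J \<Longrightarrow> - f \<in> J" "f \<in> J \<Longrightarrow> g \<in> J \<Longrightarrow> f - g \<in> J" "f \<in> J \<Longrightarrow> f * s \<in> J"
proof -
  show base: "0 \<in> J" "f \<in> J \<Longrightarrow> g \<in> J \<Longrightarrow> f + g \<in> J" "f \<in> J \<Longrightarrow> s * f \<in> J" for f g s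
    using assms by (auto simp: is_ideal_def)
  show neg: "f \<in> J \<Longrightarrow> - f \<in> J" for f
    using base(3)[of f "- 1"] by simp
  show "f \<in> J \<Longrightarrow> g \<in> J \<Longrightarrow> f - g \<in> J"
    using base(2)[of f "- g"] neg by simp
  show "f \<in> J \<Longrightarrow> f * s \<in> J"
    using base(3)[of f s] by (simp add: mult.commute)
qed

lemma is_ideal_sum: "is_ideal J \<Longrightarrow> (\<And>a. a \<in> A \<Longrightarrow> f a \<in> J) \<Longrightarrow> sum f A \<in> J"
  by (induction A rule: infinite_finite_induct) (auto intro: is_idealD)

lemma is_ideal_diff_cancel: "is_ideal J \<Longrightarrow> f - g \<in> J \<Longrightarrow> f \<in> J \<longleftrightarrow> g \<in> J"
  using is_idealD(2)[of J "f - g" g] is_idealD(5)[of J f "f - g"] by auto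

lemma ideal_S_ring_iff:
  fixes J :: "('n::finite, 'k::field) mpoly set"
  shows "ideal J S_ring \<longleftrightarrow> is_ideal J"
proof
  assume "ideal J S_ring"
  then interpret ideal J S_ring .
  show "is_ideal J"
    unfolding is_ideal_def
    using additive_subgroup.zero_closed[OF additive_subgroup_axioms]
      additive_subgroup.a_closed[OF additive_subgroup_axioms] I_l_closed by auto
next
  assume J: "is_ideal J"
  interpret R: cring "S_ring :: ('n, 'k) mpoly ring" by (rule S_ring_cring)
  show "ideal J S_ring"
  proof (rule idealI)
    show "ring S_ring" by (rule cring.axioms(1)[OF S_ring_cring])
    show "subgroup J (add_monoid S_ring)"
    proof (rule R.add.subgroupI)
      show "J \<noteq> {}" using is_idealD(1)[OF J] by blast
      fix a assume a: "a \<in> J"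
      have "\<ominus>\<^bsub>S_ring\<^esub> a = - a"
        by (rule R.minus_equality) auto
      then show "\<ominus>\<^bsub>S_ring\<^esub> a \<in> J"
        using is_idealD(4)[OF J a] by simp
    qed (use J in \<open>auto intro: is_idealD\<close>)
  qed (use J in \<open>auto intro: is_idealD\<close>)
qed

text \<open>
  For an up-set \<open>E\<close> this is a monomial ideal, and all monomial ideals arise in this way.
\<close>

definition poly_span :: "('n::finite \<Rightarrow>\<^sub>0 nat) set \<Rightarrow> ('n, 'k::field) mpoly set" where
  "poly_span E = {f. keys f \<subseteq> E}"

lemma mem_poly_span: "f \<in> poly_span E \<longleftrightarrow> (\<forall>m. lookup f m \<noteq> 0 \<longrightarrow> m \<in> E)"
  by (auto simp: poly_span_def in_keys_iff)

lemma monom_mem_poly_span [simp]: "mon m \<in> poly_span E \<longleftrightarrow> m \<in> E"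
  by (auto simp: poly_span_def)

lemma poly_span_subset_iff [simp]: "poly_span E \<subseteq> (poly_span F :: ('n::finite, 'k::field) mpoly set) \<longleftrightarrow> E \<subseteq> F"
proof
  assume "poly_span E \<subseteq> (poly_span F :: ('n, 'k) mpoly set)"
  then show "E \<subseteq> F"
    by (metis monom_mem_poly_span subset_eq)
qed (auto simp: poly_span_def)

lemma poly_span_eq_iff: "poly_span E = (poly_span F :: ('n::finite, 'k::field) mpoly set) \<longleftrightarrow> E = F"
  using poly_span_subset_iff[of E F] poly_span_subset_iff[of F E] by blast

lemma poly_span_UNIV [simp]: "poly_span UNIV = UNIV"
  by (simp add: poly_span_def)

lemma poly_span_empty [simp]: "poly_span {} = {0}"
  by (auto simp: poly_span_def)

lemma is_ideal_poly_span:
  assumes "upset E"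
  shows "is_ideal (poly_span E :: ('n::finite, 'k::field) mpoly set)"
  unfolding is_ideal_def
proof (intro conjI ballI allI)
  fix f g :: "('n, 'k) mpoly" assume "f \<in> poly_span E" "g \<in> poly_span E"
  then show "f + g \<in> poly_span E"
    using Poly_Mapping.keys_add[of f g] by (auto simp: poly_span_def)
next
  fix s f :: "('n, 'k) mpoly" assume "f \<in> poly_span E"
  then show "s * f \<in> poly_span E"
    using keys_mult[of f s] upsetD[OF assms] by (force simp: poly_span_def mult.commute)
qed (simp add: poly_span_def)

lemma lookup_single_mult: "lookup (Poly_Mapping.single m c * f) (m + p) = c * lookup f p"
  for f :: "('n::finite, 'k::field) mpoly"
proof -
  have "lookup (Poly_Mapping.single m c * f) (m + p)
      = (\<Sum>l. (c when m = l) * (\<Sum>q. lookup f q when m + p = l + q))"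
    by (simp add: lookup_mult lookup_single)
  also have "(\<lambda>l. (c when m = l) * (\<Sum>q. lookup f q when m + p = l + q))
      = (\<lambda>l. c * (\<Sum>q. lookup f q when m + p = m + q) when m = l)"
    by (auto simp: fun_eq_iff when_def)
  finally show ?thesis by simp
qed

lemma keys_single_mult_subset: "q \<in> keys (Poly_Mapping.single m c * f) \<Longrightarrow> \<exists>p\<in>keys f. q = m + p"
  for f :: "('n::finite, 'k::field) mpoly"
  using keys_mult[of "Poly_Mapping.single m c" f] by (auto split: if_splits)

lemma poly_sum_monoms: "f = (\<Sum>m\<in>keys f. Poly_Mapping.single m (lookup f m))"
  by (rule poly_mapping_eqI)
     (auto simp: lookup_sum lookup_single when_def in_keys_iff sum.delta')

definition monom_closed :: "('n::finite, 'k::field) mpoly set \<Rightarrow> bool" where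
  "monom_closed J \<longleftrightarrow> (\<forall>f\<in>J. \<forall>m\<in>keys f. mon m \<in> J)"

lemma single_eq_mult_monom: "Poly_Mapping.single m c = Poly_Mapping.single 0 c * (mon m :: ('n::finite, 'k::field) mpoly)"
  by (simp add: mult_single)

lemma poly_span_subset_ideal:
  fixes J :: "('n::finite, 'k::field) mpoly set"
  assumes "is_ideal J" "\<And>e. e \<in> E \<Longrightarrow> mon e \<in> J"
  shows "poly_span E \<subseteq> J"
proof
  fix f :: "('n, 'k) mpoly" assume f: "f \<in> poly_span E"
  have "(\<Sum>m\<in>keys f. Poly_Mapping.single m (lookup f m)) \<in> J"
  proof (rule is_ideal_sum[OF assms(1)])
    fix m assume "m \<in> keys f"
    with f have "mon m \<in> J" by (auto simp: poly_span_def assms(2))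
    then show "Poly_Mapping.single m (lookup f m) \<in> J"
      by (subst single_eq_mult_monom) (rule is_idealD(3)[OF assms(1)])
  qed
  then show "f \<in> J" by (simp flip: poly_sum_monoms)
qed

text \<open>
  An ideal that contains the monomials of its elements is determined by its monomials.
\<close>

lemma monom_closed_eq_poly_span:
  assumes J: "is_ideal J" "monom_closed J"
  shows "J = poly_span {m. mon m \<in> J}" "upset {m. mon m \<in> J}"
proof -
  show "J = poly_span {m. mon m \<in> J}"
  proof
    show "J \<subseteq> poly_span {m. mon m \<in> J}"
      using J(2) by (auto simp: poly_span_def monom_closed_def)
    show "poly_span {m. mon m \<in> J} \<subseteq> J"
      by (rule poly_span_subset_ideal[OF J(1)]) simp
  qed
  show "upset {m. mon m \<in> J}"
    unfolding upset_def
  proof safe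
    fix p q assume "mon p \<in> J"
    then have "mon q * mon p \<in> J" by (rule is_idealD(3)[OF J(1)])
    then show "mon (p + q) \<in> J" by (simp add: mult_single add.commute)
  qed
qed

text \<open>
  The up-set consists of the multiples of the generators.
\<close>

lemma monomial_ideal_poly_span:
  fixes I :: "('n::finite, 'k::field) mpoly set"
  assumes "monomial_ideal I"
  obtains E where "upset E" "I = poly_span E"
proof -
  obtain G where G: "G \<subseteq> monomials" "I = Idl\<^bsub>S_ring\<^esub> G"
    using assms by (auto simp: monomial_ideal_def)
  define E where "E = {g + p | g p. mon g \<in> G}"
  have up: "upset E"
    by (force simp: upset_def E_def add.assoc)
  interpret R: cring "S_ring :: ('n, 'k) mpoly ring" by (rule S_ring_cring)
  have I: "is_ideal I"
    using R.genideal_ideal[of G] G(2) by (simp add: ideal_S_ring_iff)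
  have "g \<in> poly_span E" if g: "g \<in> G" for g
  proof -
    obtain m where m: "g = mon m" using g G(1) by (auto simp: monomials_def)
    with g have "m + 0 \<in> E" unfolding E_def by blast
    then show ?thesis by (simp add: m)
  qed
  then have "I \<subseteq> poly_span E"
    unfolding G(2) using up by (intro R.genideal_minimal) (auto simp: ideal_S_ring_iff is_ideal_poly_span)
  moreover have "mon e \<in> I" if e: "e \<in> E" for e
  proof -
    obtain g p where gp: "e = g + p" "mon g \<in> G" using e by (auto simp: E_def)
    then have "mon g \<in> I" using R.genideal_self[of G] G(2) by auto
    then have "mon p * mon g \<in> I" by (rule is_idealD(3)[OF I])
    then show ?thesis by (simp add: gp mult_single add.commute)
  qed
  ultimately have "I = poly_span E"
    using poly_span_subset_ideal[OF I, of E] by blast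
  then show thesis using up that by blast
qed

lemma genideal_insert_monom:
  assumes "upset E"
  shows "Idl\<^bsub>S_ring\<^esub> (poly_span E \<union> {mon u}) = (poly_span (E \<union> cell u UNIV) :: ('n::finite, 'k::field) mpoly set)"
    (is "Idl\<^bsub>S_ring\<^esub> ?G = poly_span ?F")
proof
  interpret R: cring "S_ring :: ('n, 'k) mpoly ring" by (rule S_ring_cring)
  have J: "is_ideal (Idl\<^bsub>S_ring\<^esub> ?G)"
    using R.genideal_ideal[of ?G] by (simp add: ideal_S_ring_iff)
  have G: "?G \<subseteq> Idl\<^bsub>S_ring\<^esub> ?G"
    by (rule R.genideal_self) simp
  have "?G \<subseteq> poly_span ?F"
    using poly_span_subset_iff[of E ?F] by auto
  moreover have "is_ideal (poly_span ?F)"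
    by (intro is_ideal_poly_span upset_Un assms upset_cell_UNIV)
  ultimately show "Idl\<^bsub>S_ring\<^esub> ?G \<subseteq> poly_span ?F"
    by (intro R.genideal_minimal) (auto simp: ideal_S_ring_iff)
  show "poly_span ?F \<subseteq> Idl\<^bsub>S_ring\<^esub> ?G"
  proof (rule poly_span_subset_ideal[OF J])
    fix e assume "e \<in> ?F"
    then consider "e \<in> E" | q where "e = u + q"
      unfolding mem_cell_iff Un_iff by blast
    then show "mon e \<in> Idl\<^bsub>S_ring\<^esub> ?G"
    proof cases
      case 1
      then show ?thesis using G by auto
    next
      case 2
      have "mon q * mon u \<in> Idl\<^bsub>S_ring\<^esub> ?G"
        using G by (intro is_idealD(3)[OF J]) auto
      then show ?thesis by (simp add: 2 mult_single add.commute)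
    qed
  qed
qed

section \<open>Monomial prime ideals\<close>

text \<open>
  The prime ideal \<open>(x\<^sub>j | j \<notin> B)\<close>: a monomial lies in it if it involves a variable
  outside \<open>B\<close>.
\<close>

definition var_prime :: "'n set \<Rightarrow> ('n::finite, 'k::field) mpoly set" where
  "var_prime B = poly_span {p. \<exists>j. j \<notin> B \<and> lookup p j > 0}"

lemma upset_var_prime: "upset {p. \<exists>j. j \<notin> B \<and> lookup p j > 0}"
  by (force simp: upset_def lookup_add)

lemma is_ideal_var_prime: "is_ideal (var_prime B)"
  unfolding var_prime_def by (rule is_ideal_poly_span[OF upset_var_prime])

lemma var_prime_subset_iff: "var_prime B \<subseteq> (var_prime C :: ('n::finite, 'k::field) mpoly set) \<longleftrightarrow> C \<subseteq> B"
proof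
  assume "var_prime B \<subseteq> (var_prime C :: ('n, 'k) mpoly set)"
  then have sub: "{p :: 'n \<Rightarrow>\<^sub>0 nat. \<exists>j. j \<notin> B \<and> lookup p j > 0} \<subseteq> {p. \<exists>j. j \<notin> C \<and> lookup p j > 0}"
    by (simp add: var_prime_def)
  have "j \<in> B" if "j \<in> C" for j
  proof (rule ccontr)
    assume "j \<notin> B"
    then have "unit_expo j \<in> {p. \<exists>j. j \<notin> B \<and> lookup p j > 0}" by (auto intro!: exI[of _ j])
    with sub have "unit_expo j \<in> {p. \<exists>j. j \<notin> C \<and> lookup p j > 0}" by blast
    then show False using that by (auto simp: lookup_single when_def split: if_splits)
  qed
  then show "C \<subseteq> B" by blast
qed (auto simp: var_prime_def)

lemma var_prime_eq_iff: "var_prime B = (var_prime C :: ('n::finite, 'k::field) mpoly set) \<longleftrightarrow> B = C"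
  using var_prime_subset_iff[of B C] var_prime_subset_iff[of C B] by blast

definition is_prime :: "('n::finite, 'k::field) mpoly set \<Rightarrow> bool" where
  "is_prime P \<longleftrightarrow> is_ideal P \<and> 1 \<notin> P \<and> (\<forall>f g. f * g \<in> P \<longrightarrow> f \<in> P \<or> g \<in> P)"

lemma primeideal_S_ring_iff:
  fixes P :: "('n::finite, 'k::field) mpoly set"
  shows "primeideal P S_ring \<longleftrightarrow> is_prime P"
proof
  assume "primeideal P S_ring"
  then interpret primeideal P S_ring .
  show "is_prime P"
    using one_imp_carrier I_notcarr I_prime ideal_axioms
    by (auto simp: is_prime_def ideal_S_ring_iff)
next
  assume "is_prime P"
  then show "primeideal P S_ring"
    by (intro primeidealI S_ring_cring) (auto simp: is_prime_def ideal_S_ring_iff)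
qed

text \<open>
  This replaces the choice of leading monomials with respect to a term order. One coordinate after the
  other is maximized on \<open>A\<close> and on \<open>B\<close>; a sum in which both summands are maximal can only be
  reached from maximal summands.
\<close>

lemma unique_sum_refine:
  fixes A B :: "('n::finite \<Rightarrow>\<^sub>0 nat) set"
  assumes "finite A" "finite B" "A \<noteq> {}" "B \<noteq> {}" "finite I"
  shows "\<exists>A' B'. A' \<subseteq> A \<and> B' \<subseteq> B \<and> A' \<noteq> {} \<and> B' \<noteq> {} \<and>
    (\<forall>i\<in>I. \<forall>p\<in>A'. \<forall>q\<in>A'. lookup p i = lookup q i) \<and>
    (\<forall>i\<in>I. \<forall>p\<in>B'. \<forall>q\<in>B'. lookup p i = lookup q i) \<and>
    (\<forall>p\<in>A'. \<forall>q\<in>B'. \<forall>p'\<in>A. \<forall>q'\<in>B. p + q = p' + q' \<longrightarrow> p' \<in> A' \<and> q' \<in> B')"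
  using assms(5)
proof (induction I)
  case empty
  then show ?case using assms by (intro exI[of _ A] exI[of _ B]) auto
next
  case (insert x I)
  then obtain A1 B1 where AB: "A1 \<subseteq> A" "B1 \<subseteq> B" "A1 \<noteq> {}" "B1 \<noteq> {}"
    "\<forall>i\<in>I. \<forall>p\<in>A1. \<forall>q\<in>A1. lookup p i = lookup q i"
    "\<forall>i\<in>I. \<forall>p\<in>B1. \<forall>q\<in>B1. lookup p i = lookup q i"
    "\<forall>p\<in>A1. \<forall>q\<in>B1. \<forall>p'\<in>A. \<forall>q'\<in>B. p + q = p' + q' \<longrightarrow> p' \<in> A1 \<and> q' \<in> B1"
    by blast
  have fin: "finite A1" "finite B1" using AB assms finite_subset by blast+
  define a b where "a = Max ((\<lambda>p. lookup p x) ` A1)" and "b = Max ((\<lambda>p. lookup p x) ` B1)"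
  define A2 B2 where "A2 = {p\<in>A1. lookup p x = a}" and "B2 = {p\<in>B1. lookup p x = b}"
  have le: "p \<in> A1 \<Longrightarrow> lookup p x \<le> a" "q \<in> B1 \<Longrightarrow> lookup q x \<le> b" for p q
    using fin by (auto simp: a_def b_def)
  have "a \<in> (\<lambda>p. lookup p x) ` A1"
    unfolding a_def using fin(1) AB(3) by (intro Max_in) auto
  moreover have "b \<in> (\<lambda>p. lookup p x) ` B1"
    unfolding b_def using fin(2) AB(4) by (intro Max_in) auto
  ultimately have ne: "A2 \<noteq> {}" "B2 \<noteq> {}" by (auto simp: A2_def B2_def)
  have uniq: "p' \<in> A2 \<and> q' \<in> B2"
    if "p \<in> A2" "q \<in> B2" "p' \<in> A" "q' \<in> B" "p + q = p' + q'" for p q p' q'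
  proof -
    have "p' \<in> A1" "q' \<in> B1" using AB(7) that by (auto simp: A2_def B2_def)
    moreover have "lookup p' x + lookup q' x = a + b"
      using that(1,2) arg_cong[OF that(5), of "\<lambda>p. lookup p x", unfolded lookup_add]
      by (simp add: A2_def B2_def)
    ultimately show ?thesis using le(1)[of p'] le(2)[of q'] by (auto simp: A2_def B2_def)
  qed
  show ?case
  proof (rule exI[of _ A2], rule exI[of _ B2], intro conjI ballI impI)
    show "A2 \<subseteq> A" "B2 \<subseteq> B" using AB(1,2) by (auto simp: A2_def B2_def)
  next
    fix i p q assume "i \<in> insert x I" "p \<in> A2" "q \<in> A2"
    then show "lookup p i = lookup q i" using AB(5) by (auto simp: A2_def)
  next
    fix i p q assume "i \<in> insert x I" "p \<in> B2" "q \<in> B2"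
    then show "lookup p i = lookup q i" using AB(6) by (auto simp: B2_def)
  next
    fix p q p' q' assume "p \<in> A2" "q \<in> B2" "p' \<in> A" "q' \<in> B" "p + q = p' + q'"
    from uniq[OF this] show "p' \<in> A2" "q' \<in> B2" by auto
  qed (rule ne)+
qed

lemma unique_sum:
  fixes A B :: "('n::finite \<Rightarrow>\<^sub>0 nat) set"
  assumes "finite A" "finite B" "A \<noteq> {}" "B \<noteq> {}"
  obtains p q where "p \<in> A" "q \<in> B"
    "\<And>p' q'. p' \<in> A \<Longrightarrow> q' \<in> B \<Longrightarrow> p' + q' = p + q \<Longrightarrow> p' = p \<and> q' = q"
proof -
  obtain A' B' where AB: "A' \<subseteq> A" "B' \<subseteq> B" "A' \<noteq> {}" "B' \<noteq> {}"
    "\<forall>i\<in>UNIV. \<forall>p\<in>A'. \<forall>q\<in>A'. lookup p i = lookup q i"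
    "\<forall>i\<in>UNIV. \<forall>p\<in>B'. \<forall>q\<in>B'. lookup p i = lookup q i"
    "\<forall>p\<in>A'. \<forall>q\<in>B'. \<forall>p'\<in>A. \<forall>q'\<in>B. p + q = p' + q' \<longrightarrow> p' \<in> A' \<and> q' \<in> B'"
    using unique_sum_refine[OF assms finite_class.finite_UNIV] by blast
  obtain p q where pq: "p \<in> A'" "q \<in> B'" using AB(3,4) by blast
  show thesis
  proof (rule that)
    fix p' q' assume p'q': "p' \<in> A" "q' \<in> B" "p' + q' = p + q"
    have "p' \<in> A'" "q' \<in> B'"
      using AB(7)[rule_format, OF pq p'q'(1,2) p'q'(3)[symmetric]] by blast+
    then have "lookup p' i = lookup p i" "lookup q' i = lookup q i" for i
      using AB(5,6) pq by blast+
    then show "p' = p \<and> q' = q" by (blast intro: expo_eqI)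
  qed (use pq AB(1,2) in auto)
qed

text \<open>
  Modulo \<open>var_prime B\<close> only the monomials in the variables of \<open>B\<close> survive. Two polynomials outside
  \<open>var_prime B\<close> both have such monomials, and a sum of exponents that is attained only once gives a
  coefficient of the product that is a product of two nonzero coefficients.
\<close>

lemma is_prime_var_prime: "is_prime (var_prime B :: ('n::finite, 'k::field) mpoly set)"
  unfolding is_prime_def
proof (intro conjI allI impI)
  show "(1 :: ('n, 'k) mpoly) \<notin> var_prime B"
    by (auto simp: var_prime_def poly_span_def)
  fix f g :: "('n, 'k) mpoly" assume fg: "f * g \<in> var_prime B"
  show "f \<in> var_prime B \<or> g \<in> var_prime B"
  proof (rule ccontr)
    define Z where "Z = {p :: 'n \<Rightarrow>\<^sub>0 nat. \<forall>j. j \<notin> B \<longrightarrow> lookup p j = 0}"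
    assume "\<not> (f \<in> var_prime B \<or> g \<in> var_prime B)"
    then have ne: "keys f \<inter> Z \<noteq> {}" "keys g \<inter> Z \<noteq> {}"
      by (auto simp: var_prime_def poly_span_def Z_def)
    have fin: "finite (keys f \<inter> Z)" "finite (keys g \<inter> Z)"
      by simp_all
    obtain p q where pq: "p \<in> keys f \<inter> Z" "q \<in> keys g \<inter> Z"
      "\<And>p' q'. p' \<in> keys f \<inter> Z \<Longrightarrow> q' \<in> keys g \<inter> Z \<Longrightarrow> p' + q' = p + q \<Longrightarrow> p' = p \<and> q' = q"
      by (rule unique_sum[OF fin ne], rule that)
    have Z: "p + q \<in> Z" using pq by (auto simp: Z_def lookup_add)
    have split: "p' \<in> Z \<and> q' \<in> Z" if "p' + q' = p + q" for p' q'
      using Z unfolding that[symmetric] by (auto simp: Z_def lookup_add)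
    have uniq: "p' = p \<and> q' = q" if "p' \<in> keys f" "q' \<in> keys g" "p' + q' = p + q" for p' q'
      using pq(3)[of p' q'] split[OF that(3)] that by blast
    have "f * g = (\<Sum>p'\<in>keys f. \<Sum>q'\<in>keys g. Poly_Mapping.single (p' + q') (lookup f p' * lookup g q'))"
      by (subst (1) poly_sum_monoms[of f], subst (1) poly_sum_monoms[of g])
        (simp add: sum_product mult_single)
    then have "lookup (f * g) (p + q)
        = (\<Sum>p'\<in>keys f. \<Sum>q'\<in>keys g. lookup f p' * lookup g q' when p' + q' = p + q)"
      by (simp add: lookup_sum lookup_single)
    also have "\<dots> = (\<Sum>p'\<in>keys f. \<Sum>q'\<in>keys g. if p' = p \<and> q' = q then lookup f p' * lookup g q' else 0)"
      using uniq by (intro sum.cong refl) (auto simp: when_def)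
    also have "\<dots> = (\<Sum>p'\<in>keys f. if p' = p then lookup f p * lookup g q else 0)"
      using pq by (intro sum.cong refl) (auto simp: sum.delta)
    also have "\<dots> = lookup f p * lookup g q"
      using pq by simp
    also have "\<dots> \<noteq> 0" using pq by (auto simp: in_keys_iff)
    finally have "p + q \<in> keys (f * g)" by (simp add: in_keys_iff)
    with fg have "\<exists>j. j \<notin> B \<and> 0 < lookup (p + q) j"
      by (auto simp: var_prime_def poly_span_def)
    with Z show False by (auto simp: Z_def)
  qed
qed (rule is_ideal_var_prime)

text \<open>
  A monomial in a prime ideal has one of its variables in the ideal, so a monomial prime is generated
  by variables.
\<close>

lemma monomial_prime_eq_var_prime:
  assumes P: "is_prime P" and E: "P = poly_span E"
  shows "P = var_prime {j. mon (unit_expo j) \<notin> P}"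
proof -
  let ?B = "{j. mon (unit_expo j) \<notin> P}"
  have id: "is_ideal P" and one: "1 \<notin> P" and prime: "\<And>f g. f * g \<in> P \<Longrightarrow> f \<in> P \<or> g \<in> P"
    using P by (auto simp: is_prime_def)
  have "(\<exists>j. j \<notin> ?B \<and> 0 < lookup p j) \<longleftrightarrow> mon p \<in> P" for p
  proof (induction p rule: expo_induct)
    case zero
    then show ?case using one by simp
  next
    case (add u j)
    have m: "mon (u + unit_expo j) = mon u * mon (unit_expo j)"
      by (simp add: mult_single)
    have "mon (u + unit_expo j) \<in> P \<longleftrightarrow> mon u \<in> P \<or> j \<notin> ?B"
      unfolding m using prime is_idealD(3,6)[OF id] by blast
    then show ?case
      using add by (auto simp: lookup_add lookup_single when_def)
  qed
  then have "E = {p. \<exists>j. j \<notin> ?B \<and> 0 < lookup p j}"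
    unfolding E by auto
  then show ?thesis unfolding var_prime_def by (metis E)
qed

section \<open>Multigraded modules presented as subquotients of the polynomial ring\<close>

abbreviation deg :: "('n::finite \<Rightarrow>\<^sub>0 nat) \<Rightarrow> ('n \<Rightarrow> int)" where
  "deg m \<equiv> (\<lambda>i. int (lookup m i))"

definition homog :: "('n::finite \<Rightarrow> int) \<Rightarrow> ('n, 'k::field) mpoly set" where
  "homog a = {f. \<forall>m. lookup f m \<noteq> 0 \<longrightarrow> deg m = a}"

lemma homog_eq_mcomp: "mcomp S_mod a = homog a"
  by (auto simp: S_mod_def homog_def in_keys_iff fun_eq_iff)

text \<open>
  The homogeneous component of degree \<open>a\<close>.
\<close>

definition hcomp :: "('n::finite \<Rightarrow> int) \<Rightarrow> ('n, 'k::field) mpoly \<Rightarrow> ('n, 'k) mpoly" where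
  "hcomp a f = Poly_Mapping.mapp (\<lambda>m c. c when deg m = a) f"

lemma lookup_hcomp: "lookup (hcomp a f) m = (lookup f m when deg m = a)"
  by (auto simp: hcomp_def lookup_mapp when_def in_keys_iff)

lemma hcomp_mem_homog: "hcomp a f \<in> homog a"
  by (auto simp: homog_def lookup_hcomp when_def)

lemma hcomp_mem_poly_span: "f \<in> poly_span E \<Longrightarrow> hcomp a f \<in> poly_span E"
  by (auto simp: mem_poly_span lookup_hcomp when_def)

lemma hcomp_diff: "hcomp a (f - g) = hcomp a f - hcomp a g"
  by (rule poly_mapping_eqI) (simp add: lookup_hcomp lookup_minus when_def)

lemma hcomp_sum: "hcomp a (sum f A) = (\<Sum>x\<in>A. hcomp a (f x))"
  by (rule poly_mapping_eqI) (auto simp: lookup_hcomp lookup_sum when_def)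

lemma hcomp_homog: "f \<in> homog b \<Longrightarrow> hcomp a f = (if a = b then f else 0)"
  by (rule poly_mapping_eqI) (auto simp: lookup_hcomp homog_def when_def)

lemma hcomp_sum_homog:
  assumes "finite A" "\<And>a. c a \<in> homog a"
  shows "hcomp b (sum c A) = (if b \<in> A then c b else 0)"
proof -
  have "hcomp b (sum c A) = (\<Sum>a\<in>A. if b = a then c b else 0)"
    unfolding hcomp_sum using hcomp_homog[OF assms(2)] by (intro sum.cong) auto
  then show ?thesis using assms(1) by simp
qed

lemma deg_inj: "deg m = deg n \<longleftrightarrow> m = n"
  by (auto simp: fun_eq_iff intro: expo_eqI)

lemma sum_hcomp:
  assumes "finite A" "deg ` keys f \<subseteq> A"
  shows "(\<Sum>a\<in>A. hcomp a f) = f"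
  by (rule poly_mapping_eqI)
     (use assms in \<open>auto simp: lookup_sum lookup_hcomp when_def sum.delta in_keys_iff image_subset_iff\<close>)

lemma hcomp_deg: "hcomp (deg m) f = Poly_Mapping.single m (lookup f m)"
  by (rule poly_mapping_eqI) (auto simp: lookup_hcomp lookup_single when_def deg_inj)

lemma homog_mult: "f \<in> homog a \<Longrightarrow> g \<in> homog b \<Longrightarrow> f * g \<in> homog (\<lambda>i. a i + b i)"
proof -
  assume f: "f \<in> homog a" and g: "g \<in> homog b"
  have "deg m = (\<lambda>i. a i + b i)" if m: "m \<in> keys (f * g)" for m
  proof -
    from m keys_mult[of f g] obtain p q where pq: "p \<in> keys f" "q \<in> keys g" and "m = p + q"
      by fastforce
    then have "deg m = (\<lambda>i. deg p i + deg q i)"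
      by (simp add: lookup_add)
    moreover have "deg p = a" "deg q = b"
      using f g pq by (auto simp: homog_def in_keys_iff)
    ultimately show ?thesis by metis
  qed
  then show ?thesis by (auto simp: homog_def in_keys_iff)
qed

lemma zero_mem_homog [simp]: "0 \<in> homog a"
  by (simp add: homog_def)

lemma homog_add: "f \<in> homog a \<Longrightarrow> g \<in> homog a \<Longrightarrow> f + g \<in> homog a"
  unfolding homog_def mem_Collect_eq lookup_add by (metis add.right_neutral)

lemma homog_minus: "f \<in> homog a \<Longrightarrow> - f \<in> homog a"
  by (simp add: homog_def)

text \<open>
  The submodules, quotients and successive quotients of a filtration are sets of cosets of cosets. To
  work with polynomials instead, such a module \<open>M\<close> is accompanied by a map \<open>\<phi>\<close> that presents
  it as \<open>J/K\<close> for ideals \<open>K \<subseteq> J\<close>: \<open>\<phi>\<close> is linear on \<open>J\<close> with kernel \<open>K\<close> and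
  onto, and the graded pieces of \<open>M\<close> are the images of homogeneous elements. The presentation passes
  to submodules (\<open>restrict_mod\<close>) and to quotients (\<open>quot_mod\<close>).
\<close>

locale subquotient =
  fixes J K :: "('n::finite, 'k::field) mpoly set"
    and \<phi> :: "('n, 'k) mpoly \<Rightarrow> 'm"
    and M :: "(('n, 'k) mpoly, 'm, 'n) mgmodule"
  assumes J: "is_ideal J" and K: "is_ideal K" and KJ: "K \<subseteq> J"
    and carrier_eq: "carrier M = \<phi> ` J"
    and zero_eq: "\<zero>\<^bsub>M\<^esub> = \<phi> 0"
    and add_eq: "\<And>f g. f \<in> J \<Longrightarrow> g \<in> J \<Longrightarrow> \<phi> f \<oplus>\<^bsub>M\<^esub> \<phi> g = \<phi> (f + g)"
    and smult_eq: "\<And>s f. f \<in> J \<Longrightarrow> s \<odot>\<^bsub>M\<^esub> \<phi> f = \<phi> (s * f)"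
    and eq_iff: "\<And>f g. f \<in> J \<Longrightarrow> g \<in> J \<Longrightarrow> \<phi> f = \<phi> g \<longleftrightarrow> f - g \<in> K"
    and mcomp_eq: "\<And>a. mcomp M a = \<phi> ` (J \<inter> homog a)"
begin

lemmas J_closed = is_idealD[OF J]

lemma eq_zero_iff: "f \<in> J \<Longrightarrow> \<phi> f = \<phi> 0 \<longleftrightarrow> f \<in> K"
  using eq_iff[of f 0] J_closed(1) by simp

lemma abelian_group: "abelian_group M"
proof (rule abelian_groupI)
  fix x assume "x \<in> carrier M"
  then obtain f where f: "f \<in> J" "x = \<phi> f" by (auto simp: carrier_eq)
  then have "\<phi> (- f) \<oplus>\<^bsub>M\<^esub> x = \<zero>\<^bsub>M\<^esub>"
    using J_closed(4) by (simp add: add_eq zero_eq)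
  then show "\<exists>y\<in>carrier M. y \<oplus>\<^bsub>M\<^esub> x = \<zero>\<^bsub>M\<^esub>"
    using f J_closed(4) by (auto simp: carrier_eq)
qed (auto simp: carrier_eq add_eq zero_eq J_closed add_ac intro!: imageI)

lemma module: "module S_ring M"
proof (rule moduleI[OF S_ring_cring abelian_group])
qed (auto simp: carrier_eq smult_eq add_eq J_closed algebra_simps)

lemma finsum_eq:
  assumes "finite A" "\<And>a. a \<in> A \<Longrightarrow> c a \<in> J" "\<And>a. a \<in> A \<Longrightarrow> g a = \<phi> (c a)"
  shows "finsum M g A = \<phi> (sum c A)"
proof -
  interpret abelian_group M by (rule abelian_group)
  show ?thesis
    using assms
  proof (induction A)
    case empty
    then show ?case by (simp add: zero_eq)
  next
    case (insert x A)
    have "g \<in> A \<rightarrow> carrier M" "g x \<in> carrier M"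
      using insert by (auto simp: carrier_eq)
    then have "finsum M g (insert x A) = g x \<oplus>\<^bsub>M\<^esub> finsum M g A"
      using insert by (simp add: finsum_insert)
    also have "\<dots> = \<phi> (c x + sum c A)"
      using insert is_ideal_sum[OF J, of A c] by (simp add: add_eq)
    finally show ?case using insert by simp
  qed
qed

lemma submodule_image:
  assumes "is_ideal J'" "J' \<subseteq> J"
  shows "submodule (\<phi> ` J') S_ring M"
proof -
  interpret module S_ring M by (rule module)
  note J' = is_idealD[OF assms(1)]
  show ?thesis
  proof (rule submoduleI)
    fix x assume "x \<in> \<phi> ` J'"
    then obtain f where f: "f \<in> J'" "x = \<phi> f" by blast
    have "\<ominus>\<^bsub>M\<^esub> x = \<phi> (- f)"
      using f assms J'(4) by (intro M.minus_equality) (auto simp: carrier_eq add_eq zero_eq subset_iff)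
    then show "\<ominus>\<^bsub>M\<^esub> x \<in> \<phi> ` J'" using f J'(4) by blast
  next
    fix x y assume "x \<in> \<phi> ` J'" "y \<in> \<phi> ` J'"
    then obtain f g where "f \<in> J'" "x = \<phi> f" "g \<in> J'" "y = \<phi> g" by blast
    then show "x \<oplus>\<^bsub>M\<^esub> y \<in> \<phi> ` J'" using assms(2) J'(2) by (auto simp: add_eq subset_iff)
  next
    fix s x assume "x \<in> \<phi> ` J'"
    then obtain f where "f \<in> J'" "x = \<phi> f" by blast
    then show "s \<odot>\<^bsub>M\<^esub> x \<in> \<phi> ` J'" using assms(2) J'(3) by (auto simp: smult_eq subset_iff)
  qed (use assms J'(1) in \<open>auto simp: carrier_eq zero_eq\<close>)
qed

definition preim :: "'m set \<Rightarrow> ('n, 'k) mpoly set" where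
  "preim N = {f \<in> J. \<phi> f \<in> N}"

lemma preim_submodule:
  assumes "submodule N S_ring M"
  shows "is_ideal (preim N)" "K \<subseteq> preim N" "preim N \<subseteq> J" "N = \<phi> ` preim N"
proof -
  interpret module S_ring M by (rule module)
  interpret N: submodule N S_ring M by (rule assms)
  have zero: "\<phi> 0 \<in> N" using N.one_closed by (simp add: zero_eq)
  show "is_ideal (preim N)"
    unfolding is_ideal_def
  proof (intro conjI ballI allI)
    show "0 \<in> preim N" using zero J_closed(1) by (simp add: preim_def)
  next
    fix f g assume "f \<in> preim N" "g \<in> preim N"
    then show "f + g \<in> preim N"
      using N.m_closed[of "\<phi> f" "\<phi> g"] J_closed(2) by (simp add: preim_def add_eq)
  next
    fix s f assume "f \<in> preim N"
    then show "s * f \<in> preim N"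
      using N.smult_closed[of s "\<phi> f"] J_closed(3) by (simp add: preim_def smult_eq)
  qed
  show "K \<subseteq> preim N"
  proof
    fix f assume "f \<in> K"
    then show "f \<in> preim N" using zero KJ eq_zero_iff[of f] by (auto simp: preim_def)
  qed
  show "preim N \<subseteq> J" by (auto simp: preim_def)
  show "N = \<phi> ` preim N"
    using N.subset by (auto simp: preim_def carrier_eq)
qed

lemma restrict_mod:
  assumes "is_ideal J'" "K \<subseteq> J'" "J' \<subseteq> J"
  shows "subquotient J' K \<phi> (restrict_mod M (\<phi> ` J'))"
proof
  fix a
  have "\<phi> f \<in> \<phi> ` (J' \<inter> homog a)" if f: "f \<in> J" "f \<in> homog a" "\<phi> f \<in> \<phi> ` J'" for f
  proof -
    obtain g where "g \<in> J'" "\<phi> f = \<phi> g" using f(3) by blast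
    then have "f - g \<in> J'" using eq_iff[of f g] f(1) assms by blast
    then have "f \<in> J'" using is_ideal_diff_cancel[OF assms(1)] \<open>g \<in> J'\<close> by blast
    then show ?thesis using f(2) by blast
  qed
  then show "mcomp (restrict_mod M (\<phi> ` J')) a = \<phi> ` (J' \<inter> homog a)"
    using assms(3) by (auto simp: restrict_mod_def mcomp_eq)
qed (use assms K in \<open>auto simp: restrict_mod_def zero_eq add_eq smult_eq eq_iff subset_iff\<close>)

lemma coset_eq:
  assumes "is_ideal J'" "J' \<subseteq> J" "f \<in> J"
  shows "\<phi> ` J' +>\<^bsub>M\<^esub> \<phi> f = {\<phi> g | g. g \<in> J \<and> g - f \<in> J'}"
proof -
  have "\<phi> ` J' +>\<^bsub>M\<^esub> \<phi> f = (\<lambda>j. \<phi> (j + f)) ` J'"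
  proof -
    have "\<phi> ` J' +>\<^bsub>M\<^esub> \<phi> f = (\<lambda>j. \<phi> j \<oplus>\<^bsub>M\<^esub> \<phi> f) ` J'"
      by (auto simp: a_r_coset_def')
    also have "\<dots> = (\<lambda>j. \<phi> (j + f)) ` J'"
      using assms(2,3) by (intro image_cong) (auto simp: add_eq)
    finally show ?thesis .
  qed
  also have "\<dots> = {\<phi> g | g. g \<in> J \<and> g - f \<in> J'}"
  proof safe
    fix j assume "j \<in> J'"
    then show "\<exists>g. \<phi> (j + f) = \<phi> g \<and> g \<in> J \<and> g - f \<in> J'"
      using assms J_closed(2) by (intro exI[of _ "j + f"]) auto
  next
    fix g assume "g - f \<in> J'"
    then show "\<phi> g \<in> (\<lambda>j. \<phi> (j + f)) ` J'"
      by (intro image_eqI[of _ _ "g - f"]) auto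
  qed
  finally show ?thesis .
qed

lemma quot_mod:
  assumes J': "is_ideal J'" "K \<subseteq> J'" "J' \<subseteq> J"
  shows "subquotient J J' (\<lambda>f. \<phi> ` J' +>\<^bsub>M\<^esub> \<phi> f) (quot_mod M (\<phi> ` J'))"
proof
  let ?N = "\<phi> ` J'"
  let ?c = "\<lambda>f. {\<phi> g | g. g \<in> J \<and> g - f \<in> J'}"
  note c = coset_eq[OF J'(1,3)]
  note J'c = is_idealD[OF J'(1)]
  show "is_ideal J" "is_ideal J'" "J' \<subseteq> J" using J J' by auto
  show "carrier (quot_mod M ?N) = (\<lambda>f. ?N +>\<^bsub>M\<^esub> \<phi> f) ` J"
    by (auto simp: quot_mod_def A_RCOSETS_def' carrier_eq)
  show "\<zero>\<^bsub>quot_mod M ?N\<^esub> = ?N +>\<^bsub>M\<^esub> \<phi> 0"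
    unfolding c[OF J_closed(1)] using J'(3) by (auto simp: quot_mod_def)
  show eq: "?N +>\<^bsub>M\<^esub> \<phi> f = ?N +>\<^bsub>M\<^esub> \<phi> g \<longleftrightarrow> f - g \<in> J'" if "f \<in> J" "g \<in> J" for f g
  proof
    assume "?N +>\<^bsub>M\<^esub> \<phi> f = ?N +>\<^bsub>M\<^esub> \<phi> g"
    then have "?c f = ?c g" using c that by simp
    moreover have "\<phi> f \<in> ?c f" using that(1) J'c(1) by auto
    ultimately have "\<phi> f \<in> ?c g" by simp
    then obtain h where "h \<in> J" "\<phi> f = \<phi> h" "h - g \<in> J'" by blast
    then have "f - h \<in> J'" using eq_iff[of f h] that J'(2) by blast
    then have "(f - h) + (h - g) \<in> J'" using \<open>h - g \<in> J'\<close> J'c(2) by blast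
    then show "f - g \<in> J'" by simp
  next
    assume fg: "f - g \<in> J'"
    have "h - f \<in> J' \<longleftrightarrow> h - g \<in> J'" for h
      using is_ideal_diff_cancel[OF J'(1), of "h - g" "h - f"] fg by simp
    then show "?N +>\<^bsub>M\<^esub> \<phi> f = ?N +>\<^bsub>M\<^esub> \<phi> g"
      using c that by simp
  qed
  show "(?N +>\<^bsub>M\<^esub> \<phi> f) \<oplus>\<^bsub>quot_mod M ?N\<^esub> (?N +>\<^bsub>M\<^esub> \<phi> g) = ?N +>\<^bsub>M\<^esub> \<phi> (f + g)"
    if "f \<in> J" "g \<in> J" for f g
  proof -
    have "set_add M (?c f) (?c g) = ?c (f + g)"
    proof (intro equalityI subsetI)
      fix x assume "x \<in> set_add M (?c f) (?c g)"
      then obtain f' g' where fg: "f' \<in> J" "f' - f \<in> J'" "g' \<in> J" "g' - g \<in> J'" "x = \<phi> f' \<oplus>\<^bsub>M\<^esub> \<phi> g'"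
        by (auto simp: set_add_def')
      then have "x = \<phi> (f' + g')" "f' + g' \<in> J" by (auto simp: add_eq J_closed)
      moreover have "(f' - f) + (g' - g) \<in> J'" using fg J'c(2) by blast
      then have "f' + g' - (f + g) \<in> J'" by (simp add: algebra_simps)
      ultimately show "x \<in> ?c (f + g)" by blast
    next
      fix x assume "x \<in> ?c (f + g)"
      then obtain h where h: "x = \<phi> h" "h \<in> J" "h - (f + g) \<in> J'" by blast
      then have "x = \<phi> f \<oplus>\<^bsub>M\<^esub> \<phi> (h - f)" "h - f \<in> J" "h - f - g \<in> J'"
        using that J_closed(5) by (auto simp: add_eq algebra_simps)
      moreover have "\<phi> f \<in> ?c f" using that J'c(1) by auto
      moreover have "\<phi> (h - f) \<in> ?c g" using calculation by blast
      ultimately show "x \<in> set_add M (?c f) (?c g)" by (auto simp: set_add_def')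
    qed
    then show ?thesis using that c J_closed(2) by (simp add: quot_mod_def)
  qed
  show "s \<odot>\<^bsub>quot_mod M ?N\<^esub> (?N +>\<^bsub>M\<^esub> \<phi> f) = ?N +>\<^bsub>M\<^esub> \<phi> (s * f)" if f: "f \<in> J" for s f
  proof -
    have "?N +>\<^bsub>M\<^esub> (s \<odot>\<^bsub>M\<^esub> x) = ?N +>\<^bsub>M\<^esub> \<phi> (s * f)" if x: "x \<in> ?c f" for x
    proof -
      obtain g where g: "x = \<phi> g" "g \<in> J" "g - f \<in> J'" using x by blast
      have "s * g - s * f \<in> J'"
        using J'c(3)[OF g(3), of s] by (simp add: algebra_simps)
      then show ?thesis
        using g f J_closed(3) eq[of "s * g" "s * f"] by (simp add: smult_eq)
    qed
    moreover have "\<phi> f \<in> ?c f" using f J'c(1) by auto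
    ultimately have "(\<Union>x\<in>?c f. ?N +>\<^bsub>M\<^esub> (s \<odot>\<^bsub>M\<^esub> x)) = ?N +>\<^bsub>M\<^esub> \<phi> (s * f)"
      by blast
    then show ?thesis using c[OF f] by (simp add: quot_mod_def)
  qed
  show "mcomp (quot_mod M ?N) a = (\<lambda>f. ?N +>\<^bsub>M\<^esub> \<phi> f) ` (J \<inter> homog a)" for a
    by (simp add: quot_mod_def mcomp_eq image_image)
qed

end

lemma subquotient_S_mod: "subquotient UNIV {0} id S_mod"
  by unfold_locales (auto simp: is_ideal_def S_mod_def homog_def in_keys_iff fun_eq_iff)

abbreviation coset :: "('n::finite, 'k::field) mpoly set \<Rightarrow> ('n, 'k) mpoly \<Rightarrow> ('n, 'k) mpoly set" where
  "coset I f \<equiv> I +>\<^bsub>S_mod\<^esub> f"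

lemma subquotient_quot_S_mod:
  assumes "is_ideal I"
  shows "subquotient UNIV I (coset I) (quot_mod S_mod I)"
  using subquotient.quot_mod[OF subquotient_S_mod assms] is_idealD(1)[OF assms] by simp

text \<open>
  If \<open>J\<close> and \<open>K\<close> are spanned by monomials then homogeneous components do not leave them. Hence the
  components of a representing polynomial give the decomposition of an element, and comparing
  components modulo \<open>K\<close> gives its uniqueness.
\<close>

lemma multigraded_module_subquotient:
  fixes \<phi> :: "('n::finite, 'k::field) mpoly \<Rightarrow> 'm"
  assumes "subquotient (poly_span F) (poly_span E) \<phi> M"
  shows "multigraded_module M"
proof -
  interpret subquotient "poly_span F" "poly_span E" \<phi> M by (rule assms)
  interpret module S_ring M by (rule module)
  show ?thesis
    unfolding multigraded_module_def
  proof (intro conjI allI ballI)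
    show "module S_ring M" by (rule module)
  next
    fix a
    have neg: "\<ominus>\<^bsub>M\<^esub> \<phi> f = \<phi> (- f)" if "f \<in> poly_span F" for f
      using that J_closed(4) by (intro M.minus_equality) (auto simp: carrier_eq add_eq zero_eq)
    have "subgroup (mcomp M a) (add_monoid M)"
    proof (rule M.add.subgroupI)
      fix x assume "x \<in> mcomp M a"
      then show "\<ominus>\<^bsub>M\<^esub> x \<in> mcomp M a"
        by (auto simp: mcomp_eq neg J_closed homog_minus)
    next
      fix x y assume "x \<in> mcomp M a" "y \<in> mcomp M a"
      then show "x \<oplus>\<^bsub>M\<^esub> y \<in> mcomp M a"
        by (auto simp: mcomp_eq add_eq J_closed homog_add)
    next
      show "mcomp M a \<noteq> {}" using J_closed(1) by (auto simp: mcomp_eq intro!: exI[of _ 0])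
    qed (auto simp: mcomp_eq carrier_eq)
    then show "additive_subgroup (mcomp M a) M" by (rule additive_subgroup.intro)
  next
    fix a b and s :: "('n, 'k) mpoly" and x assume "s \<in> mcomp S_mod a" "x \<in> mcomp M b"
    then show "s \<odot>\<^bsub>M\<^esub> x \<in> mcomp M (\<lambda>i. a i + b i)"
      by (auto simp: mcomp_eq homog_eq_mcomp smult_eq J_closed homog_mult)
  next
    fix x assume "x \<in> carrier M"
    then obtain f where f: "f \<in> poly_span F" "x = \<phi> f" by (auto simp: carrier_eq)
    define A where "A = deg ` keys f"
    define g where "g a = \<phi> (hcomp a f)" for a
    have hF: "hcomp a f \<in> poly_span F" for a
      using f(1) by (rule hcomp_mem_poly_span)
    have "hcomp a f = 0" if "a \<notin> A" for a
      using that by (intro poly_mapping_eqI) (auto simp: lookup_hcomp when_def A_def in_keys_iff)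
    then have sub: "{a. g a \<noteq> \<zero>\<^bsub>M\<^esub>} \<subseteq> A"
      by (force simp: g_def zero_eq)
    have finA: "finite A" by (simp add: A_def)
    have "finsum M g {a. g a \<noteq> \<zero>\<^bsub>M\<^esub>} = finsum M g A"
      using sub finA hF by (intro M.add.finprod_mono_neutral_cong_left) (auto simp: g_def carrier_eq)
    also have "\<dots> = \<phi> (\<Sum>a\<in>A. hcomp a f)"
      using finA hF by (intro finsum_eq) (auto simp: g_def)
    also have "(\<Sum>a\<in>A. hcomp a f) = f"
      by (rule sum_hcomp) (auto simp: finA A_def)
    finally have sum: "x = finsum M g {a. g a \<noteq> \<zero>\<^bsub>M\<^esub>}" by (simp add: f)
    show "\<exists>!g. (\<forall>a. g a \<in> mcomp M a) \<and> finite {a. g a \<noteq> \<zero>\<^bsub>M\<^esub>} \<and> x = finsum M g {a. g a \<noteq> \<zero>\<^bsub>M\<^esub>}"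
    proof (rule ex1I[of _ g])
      show "(\<forall>a. g a \<in> mcomp M a) \<and> finite {a. g a \<noteq> \<zero>\<^bsub>M\<^esub>} \<and> x = finsum M g {a. g a \<noteq> \<zero>\<^bsub>M\<^esub>}"
        using sum finite_subset[OF sub finA] hF hcomp_mem_homog by (auto simp: g_def mcomp_eq)
    next
      fix g' assume g': "(\<forall>a. g' a \<in> mcomp M a) \<and> finite {a. g' a \<noteq> \<zero>\<^bsub>M\<^esub>} \<and> x = finsum M g' {a. g' a \<noteq> \<zero>\<^bsub>M\<^esub>}"
      then have "\<forall>a. \<exists>c. c \<in> poly_span F \<inter> homog a \<and> g' a = \<phi> c"
        unfolding mcomp_eq by blast
      then obtain c where c: "\<And>a. c a \<in> poly_span F" "\<And>a. c a \<in> homog a" "\<And>a. g' a = \<phi> (c a)"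
        by (metis IntE)
      define A' where "A' = {a. g' a \<noteq> \<zero>\<^bsub>M\<^esub>}"
      have finA': "finite A'" using g' by (simp add: A'_def)
      have "x = \<phi> (sum c A')"
        using g' c finsum_eq[OF finA', of c g'] by (simp add: A'_def)
      then have diff: "f - sum c A' \<in> poly_span E"
        using f eq_iff[of f "sum c A'"] is_ideal_sum[OF J, of A' c] c(1) by simp
      show "g' = g"
      proof
        fix b
        have "hcomp b (f - sum c A') = hcomp b f - (if b \<in> A' then c b else 0)"
          using hcomp_sum_homog[of A' c b] finA' c(2) by (simp add: hcomp_diff)
        with hcomp_mem_poly_span[OF diff, of b]
        have E: "hcomp b f - (if b \<in> A' then c b else 0) \<in> poly_span E" by simp
        show "g' b = g b"
        proof (cases "b \<in> A'")
          case True
          then show ?thesis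
            using E eq_iff[OF hF[of b] c(1)[of b]] by (simp add: g_def c(3))
        next
          case False
          then have "g' b = \<phi> 0" by (simp add: A'_def zero_eq)
          then show ?thesis
            using E False eq_zero_iff[OF hF[of b]] by (simp add: g_def)
        qed
      qed
    qed
  qed
qed

text \<open>
  The preimage of a multigraded submodule is an ideal. A homogeneous decomposition in the submodule
  lifts to polynomials up to an element of the monomial ideal of \<open>E\<close>, so each monomial of an element
  of the preimage, a homogeneous component up to a scalar, lies in the preimage as well.
\<close>

lemma multigraded_submodule_iff:
  fixes \<phi> :: "('n::finite, 'k::field) mpoly \<Rightarrow> 'm"
  assumes "subquotient (poly_span F) (poly_span E) \<phi> M"
  shows "multigraded_submodule N M \<longleftrightarrow>
    (\<exists>D. upset D \<and> E \<subseteq> D \<and> D \<subseteq> F \<and> N = \<phi> ` poly_span D)"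
proof -
  interpret subquotient "poly_span F" "poly_span E" \<phi> M by (rule assms)
  show ?thesis
  proof
    assume "\<exists>D. upset D \<and> E \<subseteq> D \<and> D \<subseteq> F \<and> N = \<phi> ` poly_span D"
    then obtain D where D: "upset D" "E \<subseteq> D" "D \<subseteq> F" "N = \<phi> ` poly_span D" by blast
    then have "subquotient (poly_span D) (poly_span E) \<phi> (restrict_mod M N)"
      using restrict_mod[of "poly_span D"] by (simp add: is_ideal_poly_span)
    moreover have "submodule N S_ring M"
      using submodule_image[of "poly_span D"] D by (simp add: is_ideal_poly_span)
    ultimately show "multigraded_submodule N M"
      unfolding multigraded_submodule_def by (blast intro: multigraded_module_subquotient)
  next
    assume mg: "multigraded_submodule N M"
    define J' where "J' = preim N"
    have J': "is_ideal J'" "poly_span E \<subseteq> J'" "J' \<subseteq> poly_span F" "N = \<phi> ` J'"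
      using preim_submodule mg unfolding J'_def multigraded_submodule_def by blast+
    interpret R: subquotient J' "poly_span E" \<phi> "restrict_mod M N"
      using restrict_mod[OF J'(1-3)] J'(4) by simp
    have "monom_closed J'"
      unfolding monom_closed_def
    proof (intro ballI)
      fix f m assume f: "f \<in> J'" and m: "m \<in> keys f"
      then have "\<phi> f \<in> carrier (restrict_mod M N)" by (simp add: R.carrier_eq)
      then obtain g where g: "\<And>a. g a \<in> mcomp (restrict_mod M N) a"
        "finite {a. g a \<noteq> \<zero>\<^bsub>restrict_mod M N\<^esub>}"
        "\<phi> f = finsum (restrict_mod M N) g {a. g a \<noteq> \<zero>\<^bsub>restrict_mod M N\<^esub>}"
        using mg unfolding multigraded_submodule_def multigraded_module_def by blast
      have "\<forall>a. \<exists>c. c \<in> J' \<inter> homog a \<and> g a = \<phi> c"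
        using g(1) unfolding R.mcomp_eq by blast
      then obtain c where c: "\<And>a. c a \<in> J'" "\<And>a. c a \<in> homog a" "\<And>a. g a = \<phi> (c a)"
        by (metis IntE)
      define A where "A = {a. g a \<noteq> \<zero>\<^bsub>restrict_mod M N\<^esub>}"
      have "\<phi> f = \<phi> (sum c A)"
        using R.finsum_eq[OF g(2), of c g] c g(3) by (simp add: A_def)
      then have diff: "f - sum c A \<in> poly_span E"
        using R.eq_iff[OF f is_ideal_sum[OF J'(1), of A c]] c(1) by simp
      \<comment> \<open>There is only one monomial of each degree, so the component of degree \<open>m\<close> is a term.\<close>
      have "hcomp (deg m) (f - sum c A) = Poly_Mapping.single m (lookup f m) - (if deg m \<in> A then c (deg m) else 0)"
        using hcomp_sum_homog[of A c "deg m"] g(2) c(2) unfolding hcomp_diff hcomp_deg[of m f]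
        by (simp add: A_def)
      with hcomp_mem_poly_span[OF diff, of "deg m"]
      have "Poly_Mapping.single m (lookup f m) - (if deg m \<in> A then c (deg m) else 0) \<in> J'"
        using J'(2) by auto
      then have "Poly_Mapping.single m (lookup f m) \<in> J'"
        using is_ideal_diff_cancel[OF J'(1), of "Poly_Mapping.single m (lookup f m)"
            "if deg m \<in> A then c (deg m) else 0"] c(1)[of "deg m"] R.J_closed(1)
        by presburger
      then have "Poly_Mapping.single 0 (inverse (lookup f m)) * Poly_Mapping.single m (lookup f m) \<in> J'"
        by (rule R.J_closed(3))
      then show "mon m \<in> J'" using m by (simp add: mult_single in_keys_iff)
    qed
    then obtain D where D: "J' = poly_span D" "upset D"
      using monom_closed_eq_poly_span[OF J'(1)] by blast
    then show "\<exists>D. upset D \<and> E \<subseteq> D \<and> D \<subseteq> F \<and> N = \<phi> ` poly_span D"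
      using J'(2-4) by auto
  qed
qed

section \<open>Prime filtrations and chains of cells\<close>

lemma mult_mon_mem_poly_span: "s * mon m \<in> poly_span E \<longleftrightarrow> (\<forall>p\<in>keys s. m + p \<in> E)"
  for s :: "('n::finite, 'k::field) mpoly"
proof
  assume s: "s * mon m \<in> poly_span E"
  show "\<forall>p\<in>keys s. m + p \<in> E"
  proof
    fix p assume "p \<in> keys s"
    then have "lookup (s * mon m) (m + p) \<noteq> 0"
      using lookup_single_mult[of m 1 s p] by (simp add: mult.commute in_keys_iff)
    then show "m + p \<in> E" using s by (simp add: mem_poly_span)
  qed
next
  assume "\<forall>p\<in>keys s. m + p \<in> E"
  then show "s * mon m \<in> poly_span E"
    using keys_single_mult_subset[of _ m 1 s] unfolding poly_span_def mult.commute[of s] by blast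
qed

lemma mem_var_prime: "f \<in> var_prime B \<longleftrightarrow> (\<forall>p\<in>keys f. \<exists>j. j \<notin> B \<and> lookup p j > 0)"
  by (auto simp: var_prime_def poly_span_def)

text \<open>
  Since adding the cell to \<open>E\<close> yields an up-set, the multiples of \<open>x\<^sup>m\<close> are either in the
  cell or in \<open>E\<close>. In terms of ideals: \<open>I : x\<^sup>m = (x\<^sub>j | j \<notin> B)\<close>.
\<close>

lemma cell_colon:
  assumes "upset E" "upset (E \<union> cell m B)" "cell m B \<inter> E = {}"
  shows "m + p \<in> E \<longleftrightarrow> (\<exists>j. j \<notin> B \<and> lookup p j > 0)"
proof
  assume "m + p \<in> E"
  then have "m + p \<notin> cell m B" using assms(3) by blast
  then show "\<exists>j. j \<notin> B \<and> lookup p j > 0" by (auto simp: mem_cell_add)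
next
  assume "\<exists>j. j \<notin> B \<and> lookup p j > 0"
  then have "m + p \<notin> cell m B" by (auto simp: mem_cell_add)
  moreover have "m + p \<in> E \<union> cell m B" using assms(2) by (rule upsetD) simp
  ultimately show "m + p \<in> E" by blast
qed

lemma mult_mon_mem_cell:
  assumes "upset E" "upset (E \<union> cell m B)" "cell m B \<inter> E = {}"
  shows "s * mon m \<in> poly_span E \<longleftrightarrow> s \<in> var_prime B"
  by (simp add: mult_mon_mem_poly_span cell_colon[OF assms] mem_var_prime)

text \<open>
  Division with remainder by the monomial \<open>x\<^sup>m\<close>; the quotient is read off the coefficients of
  the multiples of \<open>x\<^sup>m\<close>.
\<close>

lemma cell_division:
  fixes f :: "('n::finite, 'k::field) mpoly"
  assumes "f \<in> poly_span (E \<union> cell m B)"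
  obtains s where "f - s * mon m \<in> poly_span E" "\<And>p. lookup s p = lookup f (m + p)"
proof
  define s where "s = Poly_Mapping.map_key (\<lambda>p. m + p) f"
  show s: "lookup s p = lookup f (m + p)" for p
    unfolding s_def by (subst map_key.rep_eq) (auto intro: injI)
  have "lookup (f - s * mon m) q = 0" if q: "q \<in> cell m B" for q
  proof -
    obtain p where "q = m + p" using q by (auto simp: mem_cell_iff)
    then show ?thesis
      using s[of p] lookup_single_mult[of m 1 s p] by (simp add: lookup_minus mult.commute)
  qed
  moreover have "lookup (f - s * mon m) q = 0" if q: "q \<notin> E \<union> cell m B" for q
  proof -
    have f0: "lookup f q = 0" using q assms by (auto simp: mem_poly_span)
    show ?thesis
    proof (cases "\<exists>p. q = m + p")
      case True
      then obtain p where "q = m + p" by blast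
      then show ?thesis
        using s[of p] lookup_single_mult[of m 1 s p] by (simp add: lookup_minus mult.commute)
    next
      case False
      then have "q \<notin> keys (mon m * s)" using keys_single_mult_subset[of q m 1 s] by blast
      then show ?thesis using f0 by (simp add: lookup_minus mult.commute in_keys_iff)
    qed
  qed
  ultimately show "f - s * mon m \<in> poly_span E"
    by (auto simp: mem_poly_span)
qed

text \<open>
  Two modules that are images of \<open>S\<close> under linear maps with the same kernel are isomorphic. The sets
  \<open>C a\<close> index the graded pieces of degree \<open>a\<close> on both sides, which makes room for a twist.
\<close>

lemma multigraded_isoI:
  fixes M :: "(('n::finite, 'k::field) mpoly, 'm, 'n) mgmodule"
    and N :: "(('n, 'k) mpoly, 'l, 'n) mgmodule"
  assumes carrier: "carrier M = range \<alpha>" "carrier N = range \<beta>"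
    and eq: "\<And>s t. \<alpha> s = \<alpha> t \<longleftrightarrow> \<beta> s = \<beta> t"
    and add: "\<And>s t. \<alpha> s \<oplus>\<^bsub>M\<^esub> \<alpha> t = \<alpha> (s + t)" "\<And>s t. \<beta> s \<oplus>\<^bsub>N\<^esub> \<beta> t = \<beta> (s + t)"
    and smult: "\<And>s t. s \<odot>\<^bsub>M\<^esub> \<alpha> t = \<alpha> (s * t)" "\<And>s t. s \<odot>\<^bsub>N\<^esub> \<beta> t = \<beta> (s * t)"
    and mcomp: "\<And>a. mcomp M a = \<alpha> ` C a" "\<And>a. mcomp N a = \<beta> ` C a"
  shows "multigraded_iso M N"
proof -
  define h where "h x = \<beta> (inv_into UNIV \<alpha> x)" for x
  have h: "h (\<alpha> s) = \<beta> s" for s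
    unfolding h_def using eq[of "inv_into UNIV \<alpha> (\<alpha> s)" s] by (simp add: f_inv_into_f)
  have "bij_betw h (carrier M) (carrier N)"
    unfolding bij_betw_def inj_on_def carrier using h eq by (auto simp: image_image)
  moreover have "h ` mcomp M a = mcomp N a" for a
    unfolding mcomp image_image h ..
  ultimately show ?thesis
    unfolding multigraded_iso_def carrier
    by (intro exI[of _ h]) (auto simp: h add smult carrier)
qed

text \<open>
  Adding a cell yields a factor that is generated by \<open>x\<^sup>m\<close>, with annihilator \<open>var_prime B\<close>.
  The isomorphism is induced by multiplication with \<open>x\<^sup>m\<close>.
\<close>

lemma cell_multigraded_iso:
  fixes \<psi> :: "('n::finite, 'k::field) mpoly \<Rightarrow> 'm"
  assumes sub: "subquotient (poly_span (E \<union> cell m B)) (poly_span E) \<psi> M"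
    and E: "upset E" "upset (E \<union> cell m B)" "cell m B \<inter> E = {}"
  shows "multigraded_iso M (twist (quot_mod S_mod (var_prime B)) (deg m))"
proof -
  interpret M: subquotient "poly_span (E \<union> cell m B)" "poly_span E" \<psi> M by (rule sub)
  interpret Q: subquotient UNIV "var_prime B :: ('n, 'k) mpoly set" "coset (var_prime B)" "quot_mod S_mod (var_prime B)"
    by (rule subquotient_quot_S_mod[OF is_ideal_var_prime])
  let ?P = "var_prime B :: ('n, 'k) mpoly set"
  have mult: "s * mon m \<in> poly_span (E \<union> cell m B)" for s :: "('n, 'k) mpoly"
    by (rule M.J_closed(3)) simp
  have division: "\<exists>s. \<psi> f = \<psi> (s * mon m) \<and> (\<forall>p. lookup s p = lookup f (m + p))"
    if f: "f \<in> poly_span (E \<union> cell m B)" for f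
  proof -
    obtain s where "f - s * mon m \<in> poly_span E" "\<And>p. lookup s p = lookup f (m + p)"
      using cell_division[OF f] by blast
    then show ?thesis using M.eq_iff[OF f mult] by blast
  qed
  show ?thesis
  proof (rule multigraded_isoI[where \<alpha> = "\<lambda>s. \<psi> (s * mon m)" and \<beta> = "coset ?P"
        and C = "\<lambda>b. homog (\<lambda>i. b i - deg m i)"])
    show "carrier M = range (\<lambda>s. \<psi> (s * mon m))"
      using division mult by (auto simp: M.carrier_eq) (metis rangeI)
    show "carrier (twist (quot_mod S_mod ?P) (deg m)) = range (coset ?P)"
      by (simp add: twist_def Q.carrier_eq)
    show "\<psi> (s * mon m) = \<psi> (t * mon m) \<longleftrightarrow> coset ?P s = coset ?P t" for s t
      using M.eq_iff[OF mult mult, of s t] Q.eq_iff[of s t] mult_mon_mem_cell[OF E, of "s - t"]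
      by (simp add: left_diff_distrib)
    show "\<psi> (s * mon m) \<oplus>\<^bsub>M\<^esub> \<psi> (t * mon m) = \<psi> ((s + t) * mon m)" for s t
      by (simp add: M.add_eq mult distrib_right)
    show "s \<odot>\<^bsub>M\<^esub> \<psi> (t * mon m) = \<psi> (s * t * mon m)" for s t
      by (simp add: M.smult_eq mult mult.assoc)
    show "mcomp M b = (\<lambda>s. \<psi> (s * mon m)) ` homog (\<lambda>i. b i - deg m i)" for b
    proof safe
      fix x assume "x \<in> mcomp M b"
      then obtain f where f: "f \<in> poly_span (E \<union> cell m B)" "f \<in> homog b" "x = \<psi> f"
        by (auto simp: M.mcomp_eq)
      then obtain s where s: "\<psi> f = \<psi> (s * mon m)" "\<And>p. lookup s p = lookup f (m + p)"
        using division by blast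
      have "deg p = (\<lambda>i. b i - deg m i)" if "lookup s p \<noteq> 0" for p
      proof -
        have "deg (m + p) = b" using f(2) that s(2) by (simp add: homog_def)
        then have "b i = deg m i + deg p i" for i by (auto simp: lookup_add)
        then show ?thesis by (simp add: fun_eq_iff)
      qed
      then show "x \<in> (\<lambda>s. \<psi> (s * mon m)) ` homog (\<lambda>i. b i - deg m i)"
        using s f by (auto simp: homog_def)
    next
      fix s :: "('n, 'k) mpoly" assume s: "s \<in> homog (\<lambda>i. b i - deg m i)"
      have "mon m \<in> (homog (deg m) :: ('n, 'k) mpoly set)"
        by (auto simp: homog_def lookup_single when_def)
      then have "s * mon m \<in> homog (\<lambda>i. (b i - deg m i) + deg m i)"
        using s by (intro homog_mult)
      then have "s * mon m \<in> homog b" by simp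
      then show "\<psi> (s * mon m) \<in> mcomp M b"
        using mult by (auto simp: M.mcomp_eq)
    qed
  qed (auto simp: twist_def Q.add_eq Q.smult_eq Q.mcomp_eq)
qed

text \<open>
  The generator \<open>1\<close> of \<open>S/P\<close> has degree \<open>a\<close> in the twist, so it corresponds to the class of a
  homogeneous polynomial, that is, of a scalar multiple of a monomial \<open>x\<^sup>m\<close>. Its annihilator
  \<open>P\<close> is the colon ideal of the monomial ideal of \<open>E\<close> by \<open>x\<^sup>m\<close>, so \<open>P\<close> is a monomial
  prime, and since the class of \<open>x\<^sup>m\<close> generates the module, the new exponents are those of the
  multiples of \<open>x\<^sup>m\<close> outside \<open>E\<close>.
\<close>

lemma multigraded_iso_cell:
  fixes \<psi> :: "('n::finite, 'k::field) mpoly \<Rightarrow> 'm"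
  assumes sub: "subquotient (poly_span F) (poly_span E) \<psi> M"
    and E: "upset E" "upset F" "E \<subseteq> F" and P: "is_prime P"
    and iso: "multigraded_iso M (twist (quot_mod S_mod P) a)"
  shows "\<exists>m B. P = var_prime B \<and> cell m B \<inter> E = {} \<and> F = E \<union> cell m B"
proof -
  interpret M: subquotient "poly_span F" "poly_span E" \<psi> M by (rule sub)
  have idP: "is_ideal P" and oneP: "1 \<notin> P" using P by (auto simp: is_prime_def)
  interpret Q: subquotient UNIV P "coset P" "quot_mod S_mod P"
    by (rule subquotient_quot_S_mod[OF idP])
  let ?N = "twist (quot_mod S_mod P) a"
  obtain h where iso_h: "bij_betw h (carrier M) (carrier ?N) \<and>
      (\<forall>x\<in>carrier M. \<forall>y\<in>carrier M. h (x \<oplus>\<^bsub>M\<^esub> y) = h x \<oplus>\<^bsub>?N\<^esub> h y) \<and>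
      (\<forall>s. \<forall>x\<in>carrier M. h (s \<odot>\<^bsub>M\<^esub> x) = s \<odot>\<^bsub>?N\<^esub> h x) \<and>
      (\<forall>b. h ` mcomp M b = mcomp ?N b)"
    using iso unfolding multigraded_iso_def by (rule exE)
  have h: "bij_betw h (carrier M) (carrier ?N)"
    using iso_h by (rule conjunct1)
  have lin: "h (s \<odot>\<^bsub>M\<^esub> x) = s \<odot>\<^bsub>?N\<^esub> h x" if "x \<in> carrier M" for s x
    using iso_h that by simp
  have mc: "h ` mcomp M b = mcomp ?N b" for b
    using iso_h by simp
  have N: "carrier ?N = range (coset P)" "\<And>b. mcomp ?N b = coset P ` homog (\<lambda>i. b i - a i)"
    "\<And>s t. s \<odot>\<^bsub>?N\<^esub> coset P t = coset P (s * t)"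
    by (simp_all add: twist_def Q.carrier_eq Q.mcomp_eq Q.smult_eq)
  have "1 \<in> homog (\<lambda>i. a i - a i)"
    by (auto simp: homog_def lookup_one when_def)
  then have "coset P 1 \<in> mcomp ?N a" unfolding N(2) by blast
  then obtain f where f: "f \<in> poly_span F" "f \<in> homog a" "h (\<psi> f) = coset P 1"
    unfolding mc[symmetric] M.mcomp_eq by auto
  have sf: "h (\<psi> (s * f)) = coset P s" for s
    using lin[of "\<psi> f" s] f(1,3) by (simp add: M.carrier_eq M.smult_eq N(3))
  have inj: "\<psi> g = \<psi> g'" if "h (\<psi> g) = h (\<psi> g')" "g \<in> poly_span F" "g' \<in> poly_span F" for g g'
    using inj_onD[OF bij_betw_imp_inj_on[OF h] that(1)] that(2,3) by (simp add: M.carrier_eq)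
  have colon: "s * f \<in> poly_span E \<longleftrightarrow> s \<in> P" for s
  proof -
    have "s * f \<in> poly_span E \<longleftrightarrow> \<psi> (s * f) = \<psi> (0 * f)"
      using M.eq_zero_iff[OF M.J_closed(3)[OF f(1)]] by simp
    also have "\<dots> \<longleftrightarrow> coset P s = coset P 0"
      using sf[of s] sf[of 0] inj[of "s * f" "0 * f"] M.J_closed(1,3) f(1) by fastforce
    also have "\<dots> \<longleftrightarrow> s \<in> P" using Q.eq_zero_iff[of s] by simp
    finally show ?thesis .
  qed
  have "f \<noteq> 0"
    using colon[of 1] oneP M.K is_idealD(1) by fastforce
  then obtain m where m: "m \<in> keys f" by (metis keys_eq_empty ex_in_conv)
  define c where "c = lookup f m"
  have c: "c \<noteq> 0" using m by (simp add: c_def in_keys_iff)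
  have "a = deg m" using m f(2) by (auto simp: homog_def in_keys_iff)
  then have fm: "f = Poly_Mapping.single m c"
    using hcomp_homog[OF f(2), of "deg m"] by (simp add: hcomp_deg c_def)
  have fm': "s * f = Poly_Mapping.single 0 c * (s * mon m)" "Poly_Mapping.single 0 (inverse c) * (s * f) = s * mon m" for s
    using c by (simp_all add: fm mult_single ac_simps mult.left_commute[of _ s])
  have "s * f \<in> poly_span E \<longleftrightarrow> s * mon m \<in> poly_span E" for s
    using fm'[of s] is_idealD(3)[OF M.K] by metis
  then have "s \<in> P \<longleftrightarrow> (\<forall>p\<in>keys s. m + p \<in> E)" for s
    using colon[of s] mult_mon_mem_poly_span[of s m E] by blast
  then have Peq: "P = poly_span {p. m + p \<in> E}"
    unfolding poly_span_def by blast
  define B where "B = {j. mon (unit_expo j) \<notin> P}"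
  have PB: "P = var_prime B"
    unfolding B_def by (rule monomial_prime_eq_var_prime[OF P Peq])
  have "{p. m + p \<in> E} = {p. \<exists>j. j \<notin> B \<and> lookup p j > 0}"
    using trans[OF sym[OF Peq] PB[unfolded var_prime_def]] by (simp only: poly_span_eq_iff)
  then have mE: "m + p \<in> E \<longleftrightarrow> (\<exists>j. j \<notin> B \<and> lookup p j > 0)" for p
    by blast
  have mF: "m \<in> F" using f(1) m by (auto simp: poly_span_def)
  have "cell m B \<inter> E = {}"
    using mE by (auto simp: mem_cell_iff)
  moreover have "cell m B \<subseteq> F"
    using upsetD[OF E(2) mF] by (auto simp: mem_cell_iff)
  moreover have "q \<in> E \<union> cell m B" if q: "q \<in> F" for q
  proof (cases "q \<in> E")
    case False
    have "h (\<psi> (mon q)) \<in> carrier ?N"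
      using h q unfolding bij_betw_def M.carrier_eq by auto
    then obtain s where "h (\<psi> (mon q)) = coset P s" unfolding N(1) by blast
    then have "\<psi> (mon q) = \<psi> (s * f)"
      using sf[of s] q f(1) M.J_closed(3) by (intro inj) auto
    then have "mon q - s * f \<in> poly_span E"
      using M.eq_iff q f(1) M.J_closed(3) by simp
    then have "lookup (s * f) q \<noteq> 0"
      using False by (auto simp: mem_poly_span lookup_minus)
    then have "q \<in> keys (Poly_Mapping.single m c * s)" by (simp add: fm in_keys_iff mult.commute)
    then obtain p where "q = m + p" using keys_single_mult_subset by blast
    then show ?thesis using mE[of p] False by (auto simp: mem_cell_add)
  qed simp
  ultimately show ?thesis using PB E(3) by blast
qed

lemma multigraded_prime_var_prime: "multigraded_prime (var_prime B :: ('n::finite, 'k::field) mpoly set)"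
proof -
  have "subquotient (poly_span UNIV) (poly_span {}) id (S_mod :: (('n, 'k) mpoly, ('n, 'k) mpoly, 'n) mgmodule)"
    using subquotient_S_mod by simp
  then have "multigraded_submodule (var_prime B) (S_mod :: (('n, 'k) mpoly, ('n, 'k) mpoly, 'n) mgmodule)"
    using upset_var_prime[of B] multigraded_submodule_iff[of UNIV "{}" id S_mod "var_prime B"]
    unfolding var_prime_def by auto
  then show ?thesis
    by (simp add: multigraded_prime_def primeideal_S_ring_iff is_prime_var_prime)
qed

lemma (in subquotient) image_subset_iff:
  assumes "J1 \<subseteq> J" "is_ideal J2" "K \<subseteq> J2" "J2 \<subseteq> J"
  shows "\<phi> ` J1 \<subseteq> \<phi> ` J2 \<longleftrightarrow> J1 \<subseteq> J2"
proof
  assume sub: "\<phi> ` J1 \<subseteq> \<phi> ` J2"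
  show "J1 \<subseteq> J2"
  proof
    fix f assume f: "f \<in> J1"
    then obtain g where "g \<in> J2" "\<phi> f = \<phi> g" using sub by blast
    then have "f - g \<in> J2" using eq_iff[of f g] assms f by blast
    then show "f \<in> J2" using is_ideal_diff_cancel[OF assms(2)] \<open>g \<in> J2\<close> by blast
  qed
qed blast

text \<open>
  A single step of a prime filtration is the addition of a single cell.
\<close>

lemma prime_filtration_step_iff:
  fixes \<phi> :: "('n::finite, 'k::field) mpoly \<Rightarrow> 'm"
  assumes sub: "subquotient (poly_span G) (poly_span E) \<phi> M"
    and up: "upset D" "upset D'" and D: "E \<subseteq> D" "D \<subseteq> G" "E \<subseteq> D'" "D' \<subseteq> G"
  shows "(\<phi> ` poly_span D \<subset> \<phi> ` poly_span D' \<and> multigraded_prime P \<and>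
      (\<exists>a. multigraded_iso (quot_mod (restrict_mod M (\<phi> ` poly_span D')) (\<phi> ` poly_span D))
                           (twist (quot_mod S_mod P) a))) \<longleftrightarrow>
    (\<exists>m B. P = var_prime B \<and> cell m B \<inter> D = {} \<and> D' = D \<union> cell m B)"
    (is "?l \<longleftrightarrow> ?r")
proof -
  interpret subquotient "poly_span G" "poly_span E" \<phi> M by (rule sub)
  have image: "\<phi> ` poly_span D \<subseteq> \<phi> ` poly_span D' \<longleftrightarrow> D \<subseteq> D'" "\<phi> ` poly_span D' \<subseteq> \<phi> ` poly_span D \<longleftrightarrow> D' \<subseteq> D"
    using image_subset_iff[of "poly_span D" "poly_span D'"] image_subset_iff[of "poly_span D'" "poly_span D"] D up
    by (simp_all add: is_ideal_poly_span)
  have quot: "subquotient (poly_span D') (poly_span D)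
      (\<lambda>f. \<phi> ` poly_span D +>\<^bsub>restrict_mod M (\<phi> ` poly_span D')\<^esub> \<phi> f)
      (quot_mod (restrict_mod M (\<phi> ` poly_span D')) (\<phi> ` poly_span D))" if "D \<subseteq> D'"
    using subquotient.quot_mod[OF restrict_mod, of "poly_span D'" "poly_span D"] D up that
    by (simp add: is_ideal_poly_span)
  show ?thesis
  proof
    assume l: ?l
    then have "D \<subseteq> D'" using image by blast
    moreover have "is_prime P" using l by (simp add: multigraded_prime_def primeideal_S_ring_iff)
    ultimately show ?r
      using multigraded_iso_cell[OF quot up] l by blast
  next
    assume ?r
    then obtain m B where mB: "P = var_prime B" "cell m B \<inter> D = {}" and D': "D' = D \<union> cell m B" by blast
    have "m \<in> D'" "m \<notin> D" using mB(2) self_mem_cell[of m B] unfolding D' by blast+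
    then have "\<phi> ` poly_span D \<subset> \<phi> ` poly_span D'" using image D' by blast
    moreover have "D \<subseteq> D'" using D' by blast
    have "multigraded_iso (quot_mod (restrict_mod M (\<phi> ` poly_span D')) (\<phi> ` poly_span D))
        (twist (quot_mod S_mod P) (deg m))"
      unfolding mB(1) using quot[OF \<open>D \<subseteq> D'\<close>] up mB(2) unfolding D'
      by (rule cell_multigraded_iso)
    ultimately show ?l
      unfolding mB(1) using multigraded_prime_var_prime by blast
  qed
qed

text \<open>
  The monomial ideals that lift the members of the filtration give up-sets \<open>D i\<close>, and each step adds
  a cell. The chain from \<open>D k\<close> upwards is assembled by downward induction on \<open>k\<close>.
\<close>

lemma prime_filtration_imp_cell_chain:
  fixes E :: "('n::finite \<Rightarrow>\<^sub>0 nat) set" and P :: "nat \<Rightarrow> ('n, 'k::field) mpoly set"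
  assumes E: "upset E" and filt: "prime_filtration (quot_mod S_mod (poly_span E)) r F P"
  obtains L where "cell_chain E L" "length L = r" "\<And>i. i < r \<Longrightarrow> P (Suc i) = var_prime (snd (L ! i))"
proof -
  let ?M = "quot_mod S_mod (poly_span E :: ('n, 'k) mpoly set)"
  let ?\<phi> = "coset (poly_span E :: ('n, 'k) mpoly set)"
  have sub: "subquotient (poly_span UNIV) (poly_span E) ?\<phi> ?M"
    using subquotient_quot_S_mod[OF is_ideal_poly_span[OF E]] by simp
  interpret subquotient "poly_span UNIV" "poly_span E" ?\<phi> ?M by (rule sub)
  have F: "F 0 = {\<zero>\<^bsub>?M\<^esub>}" "F r = carrier ?M"
    "\<And>i. i \<le> r \<Longrightarrow> multigraded_submodule (F i) ?M"
    "\<And>i. i \<in> {1..r} \<Longrightarrow> F (i - 1) \<subset> F i \<and> multigraded_prime (P i) \<and>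
        (\<exists>a. multigraded_iso (quot_mod (restrict_mod ?M (F i)) (F (i - 1)))
                             (twist (quot_mod S_mod (P i)) a))"
    using filt by (simp_all add: prime_filtration_def)
  have "\<exists>D. upset D \<and> E \<subseteq> D \<and> F i = ?\<phi> ` poly_span D" if "i \<le> r" for i
    using F(3)[OF that] unfolding multigraded_submodule_iff[OF sub] by blast
  then have "\<forall>i. \<exists>D. i \<le> r \<longrightarrow> upset D \<and> E \<subseteq> D \<and> F i = ?\<phi> ` poly_span D"
    by meson
  then obtain D where "\<forall>i. i \<le> r \<longrightarrow> upset (D i) \<and> E \<subseteq> D i \<and> F i = ?\<phi> ` poly_span (D i)"
    by (rule choice[THEN exE])
  then have D: "upset (D i)" "E \<subseteq> D i" "F i = ?\<phi> ` poly_span (D i)" if "i \<le> r" for i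
    using that by simp_all
  have "?\<phi> f = ?\<phi> 0" if "f \<in> poly_span (D 0)" for f
  proof -
    have "?\<phi> f \<in> F 0" using D(3)[of 0] that by simp
    then show ?thesis by (simp add: F(1) zero_eq)
  qed
  then have "poly_span (D 0) \<subseteq> (poly_span E :: ('n, 'k) mpoly set)"
    using eq_zero_iff by (simp del: poly_span_subset_iff add: subset_iff)
  then have D0: "D 0 = E" using D(2)[of 0] by (simp add: subset_antisym)
  have "?\<phi> ` poly_span (D r) = ?\<phi> ` poly_span UNIV"
    using F(2) D(3)[of r] carrier_eq by simp
  then have "poly_span UNIV \<subseteq> (poly_span (D r) :: ('n, 'k) mpoly set)"
    using image_subset_iff[of "poly_span UNIV" "poly_span (D r)"] D[of r] by (simp add: is_ideal_poly_span)
  then have Dr: "D r = UNIV" by (simp only: poly_span_subset_iff) auto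
  have "\<exists>c. P i = var_prime (snd c) \<and> cell (fst c) (snd c) \<inter> D (i - 1) = {} \<and>
      D i = D (i - 1) \<union> cell (fst c) (snd c)" if i: "i \<in> {1..r}" for i
  proof -
    have "i - 1 \<le> r" "i \<le> r" using i by auto
    then have "\<exists>m B. P i = var_prime B \<and> cell m B \<inter> D (i - 1) = {} \<and> D i = D (i - 1) \<union> cell m B"
      using F(4)[OF i] prime_filtration_step_iff[OF sub, of "D (i - 1)" "D i" "P i"] D[of i] D[of "i - 1"]
      by simp
    then show ?thesis by auto
  qed
  then have "\<forall>i\<in>{1..r}. \<exists>c. P i = var_prime (snd c) \<and> cell (fst c) (snd c) \<inter> D (i - 1) = {} \<and>
      D i = D (i - 1) \<union> cell (fst c) (snd c)" by blast
  then obtain c where c: "\<forall>i\<in>{1..r}. P i = var_prime (snd (c i)) \<and> cell (fst (c i)) (snd (c i)) \<inter> D (i - 1) = {} \<and>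
      D i = D (i - 1) \<union> cell (fst (c i)) (snd (c i))"
    by (rule bchoice[THEN exE])
  have "cell_chain (D k) (map c [Suc k..<Suc r])" if "k \<le> r" for k
    using that
  proof (induction rule: inc_induct)
    case base
    then show ?case by (simp add: Dr)
  next
    case (step n)
    have "Suc n \<in> {1..r}" using step by simp
    with c have "cell (fst (c (Suc n))) (snd (c (Suc n))) \<inter> D n = {}"
      "D (Suc n) = D n \<union> cell (fst (c (Suc n))) (snd (c (Suc n)))"
      by fastforce+
    moreover have "[Suc n..<Suc r] = Suc n # [Suc (Suc n)..<Suc r]"
      using step by (simp add: upt_conv_Cons)
    moreover obtain m B where "c (Suc n) = (m, B)" by fastforce
    ultimately show ?case using step D(1)[of n] by simp
  qed
  from this[of 0] have "cell_chain E (map c [1..<Suc r])" by (simp add: D0)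
  then show thesis
  proof (rule that)
    fix i assume "i < r"
    then show "P (Suc i) = var_prime (snd (map c [1..<Suc r] ! i))"
      using c by (auto simp del: upt_Suc)
  qed simp
qed

lemma cell_chain_drop:
  assumes "cell_chain E L" "i \<le> length L"
  shows "cell_chain (E \<union> (\<Union>c\<in>set (take i L). cell (fst c) (snd c))) (drop i L)"
  using assms
proof (induction E L arbitrary: i rule: cell_chain.induct)
  case (2 E m B L)
  show ?case
  proof (cases i)
    case (Suc k)
    then have "cell_chain (E \<union> cell m B \<union> (\<Union>c\<in>set (take k L). cell (fst c) (snd c))) (drop k L)"
      using 2 by simp
    then show ?thesis by (simp add: Suc Un_assoc)
  qed (use 2 in simp)
qed simp

lemma cell_chain_imp_prime_filtration:
  fixes E :: "('n::finite \<Rightarrow>\<^sub>0 nat) set"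
  assumes chain: "cell_chain E L"
  shows "\<exists>F. prime_filtration (quot_mod S_mod (poly_span E :: ('n, 'k::field) mpoly set)) (length L) F
    (\<lambda>i. var_prime (snd (L ! (i - 1))))"
proof -
  let ?M = "quot_mod S_mod (poly_span E :: ('n, 'k) mpoly set)"
  let ?\<phi> = "coset (poly_span E :: ('n, 'k) mpoly set)"
  have E: "upset E" using chain by (rule cell_chain_upset)
  have sub: "subquotient (poly_span UNIV) (poly_span E) ?\<phi> ?M"
    using subquotient_quot_S_mod[OF is_ideal_poly_span[OF E]] by simp
  interpret subquotient "poly_span UNIV" "poly_span E" ?\<phi> ?M by (rule sub)
  define D where "D i = E \<union> (\<Union>c\<in>set (take i L). cell (fst c) (snd c))" for i
  have D: "cell_chain (D i) (drop i L)" if "i \<le> length L" for i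
    using cell_chain_drop[OF chain that] by (simp add: D_def)
  have step: "cell (fst (L ! i)) (snd (L ! i)) \<inter> D i = {}"
    "D (Suc i) = D i \<union> cell (fst (L ! i)) (snd (L ! i))" if "i < length L" for i
  proof -
    obtain m B where mB: "L ! i = (m, B)" by fastforce
    then have "drop i L = (m, B) # drop (Suc i) L"
      using that Cons_nth_drop_Suc[of i L] by simp
    then show "cell (fst (L ! i)) (snd (L ! i)) \<inter> D i = {}"
      using D[of i] that mB by simp
    show "D (Suc i) = D i \<union> cell (fst (L ! i)) (snd (L ! i))"
      using that by (auto simp: D_def take_Suc_conv_app_nth)
  qed
  have "prime_filtration ?M (length L) (\<lambda>i. ?\<phi> ` poly_span (D i)) (\<lambda>i. var_prime (snd (L ! (i - 1))))"
    unfolding prime_filtration_def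
  proof (intro conjI allI impI ballI)
    have "?\<phi> f = ?\<phi> 0" if "f \<in> poly_span E" for f
      using eq_zero_iff that by simp
    moreover have "0 \<in> (poly_span E :: ('n, 'k) mpoly set)" by (rule is_idealD(1)[OF K])
    moreover have "D 0 = E" by (simp add: D_def)
    ultimately show "?\<phi> ` poly_span (D 0) = {\<zero>\<^bsub>?M\<^esub>}"
      unfolding zero_eq by blast
    have "D (length L) = UNIV" using D[of "length L"] by simp
    then show "?\<phi> ` poly_span (D (length L)) = carrier ?M" by (simp add: carrier_eq)
  next
    fix i assume "i \<le> length L"
    then show "multigraded_submodule (?\<phi> ` poly_span (D i)) ?M"
      using cell_chain_upset[OF D] by (subst multigraded_submodule_iff[OF sub]) (auto simp: D_def)
  next
    fix i assume i: "i \<in> {1..length L}"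
    then obtain k where k: "i = Suc k" "k < length L" by (cases i) auto
    have "upset (D k)" "upset (D i)" "E \<subseteq> D k" "E \<subseteq> D i"
      using k cell_chain_upset[OF D[of k]] cell_chain_upset[OF D[of i]] by (auto simp: D_def)
    then have *: "?\<phi> ` poly_span (D k) \<subset> ?\<phi> ` poly_span (D i) \<and> multigraded_prime (var_prime (snd (L ! k)) :: ('n, 'k) mpoly set) \<and>
      (\<exists>a. multigraded_iso (quot_mod (restrict_mod ?M (?\<phi> ` poly_span (D i))) (?\<phi> ` poly_span (D k)))
                           (twist (quot_mod S_mod (var_prime (snd (L ! k)))) a))"
      using step[OF k(2)] k by (subst prime_filtration_step_iff[OF sub]) auto
    show "?\<phi> ` poly_span (D (i - 1)) \<subset> ?\<phi> ` poly_span (D i)"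
      "multigraded_prime (var_prime (snd (L ! (i - 1))) :: ('n, 'k) mpoly set)"
      "\<exists>a. multigraded_iso (quot_mod (restrict_mod ?M (?\<phi> ` poly_span (D i))) (?\<phi> ` poly_span (D (i - 1))))
                           (twist (quot_mod S_mod (var_prime (snd (L ! (i - 1))))) a)"
      using * by (simp_all add: k(1))
  qed
  then show ?thesis by blast
qed

section \<open>Minimal and associated primes read off a chain\<close>

text \<open>
  The localization at \<open>p\<close> vanishes if and only if some element outside \<open>p\<close> annihilates the class
  of \<open>1\<close>.
\<close>

lemma Supp_quot_S_mod:
  fixes I :: "('n::finite, 'k::field) mpoly set"
  assumes I: "is_ideal I"
  shows "Supp (quot_mod S_mod I) = {p. is_prime p \<and> I \<subseteq> p}"
proof -
  let ?M = "quot_mod S_mod I"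
  interpret subquotient UNIV I "coset I" ?M
    by (rule subquotient_quot_S_mod[OF I])
  have "localization ?M p \<noteq> {loc_rel ?M p `` {(\<zero>\<^bsub>?M\<^esub>, 1)}} \<longleftrightarrow> I \<subseteq> p" if p: "is_prime p" for p
  proof
    have one: "1 \<notin> p" using p by (simp add: is_prime_def)
    assume "localization ?M p \<noteq> {loc_rel ?M p `` {(\<zero>\<^bsub>?M\<^esub>, 1)}}"
    then show "I \<subseteq> p"
    proof (rule contrapos_np)
      assume "\<not> I \<subseteq> p"
      then obtain v where v: "v \<in> I" "v \<notin> p" by blast
      have kill: "coset I (v * f) = coset I 0" for f
        using v(1) is_idealD(6)[OF I] by (simp add: eq_zero_iff)
      have "loc_rel ?M p = (carrier ?M \<times> - p) \<times> (carrier ?M \<times> - p)"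
        using v(2) by (auto simp: loc_rel_def carrier_eq smult_eq kill intro!: exI[of _ v])
      then show "localization ?M p = {loc_rel ?M p `` {(\<zero>\<^bsub>?M\<^esub>, 1)}}"
        using one by (auto simp: localization_def quotient_def carrier_eq zero_eq)
    qed
  next
    have one: "1 \<notin> p"
      using p by (simp add: is_prime_def)
    assume Ip: "I \<subseteq> p"
    have "((coset I 1, 1), (coset I 1, 1)) \<in> loc_rel ?M p"
      using one by (auto simp: loc_rel_def carrier_eq)
    moreover have "((\<zero>\<^bsub>?M\<^esub>, 1), (coset I 1, 1)) \<notin> loc_rel ?M p"
      using Ip by (auto simp: loc_rel_def zero_eq smult_eq eq_commute[of "coset I 0"] eq_zero_iff)
    ultimately have "loc_rel ?M p `` {(coset I 1, 1)} \<noteq> loc_rel ?M p `` {(\<zero>\<^bsub>?M\<^esub>, 1)}"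
      by blast
    moreover have "loc_rel ?M p `` {(coset I 1, 1)} \<in> localization ?M p"
      using one by (auto simp: localization_def carrier_eq intro!: quotientI)
    ultimately show "localization ?M p \<noteq> {loc_rel ?M p `` {(\<zero>\<^bsub>?M\<^esub>, 1)}}"
      by auto
  qed
  then show ?thesis
    by (auto simp: Supp_def primeideal_S_ring_iff)
qed

lemma Ass_quot_S_mod:
  fixes I :: "('n::finite, 'k::field) mpoly set"
  assumes I: "is_ideal I"
  shows "Ass (quot_mod S_mod I) = {p. is_prime p \<and> (\<exists>f. p = {s. s * f \<in> I})}"
proof -
  interpret subquotient UNIV I "coset I" "quot_mod S_mod I"
    by (rule subquotient_quot_S_mod[OF I])
  show ?thesis
    by (auto simp: Ass_def primeideal_S_ring_iff carrier_eq zero_eq smult_eq eq_zero_iff)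
qed

text \<open>
  Suppose that \<open>q\<close> contains \<open>I\<close> but not the prime of the first cell \<open>m + \<nat>\<^sup>B\<close>.
  Multiplying \<open>x\<^sup>m\<close> by some element outside \<open>q\<close> leads into \<open>I\<close>, so \<open>q\<close> contains
  \<open>x\<^sup>m\<close> and with it the next ideal of the filtration. This cannot go on up to \<open>S\<close>.
\<close>

lemma cell_chain_prime_contains:
  fixes q :: "('n::finite, 'k::field) mpoly set"
  assumes "cell_chain E L" "is_prime q" "poly_span E \<subseteq> q"
  shows "\<exists>B\<in>set (map snd L). var_prime B \<subseteq> q"
  using assms(1,3)
proof (induction E L rule: cell_chain.induct)
  case (1 E)
  then show ?case using assms(2) by (auto simp: is_prime_def)
next
  case (2 E m B L)
  have id: "is_ideal q" and prime: "\<And>f g. f * g \<in> q \<Longrightarrow> f \<in> q \<or> g \<in> q"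
    using assms(2) by (auto simp: is_prime_def)
  show ?case
  proof (cases "(var_prime B :: ('n, 'k) mpoly set) \<subseteq> q")
    case False
    then obtain f :: "('n, 'k) mpoly" where f: "f \<in> var_prime B" "f \<notin> q" by blast
    have "f * mon m \<in> poly_span E"
      using mult_mon_mem_cell[of E m B f] 2(2) f(1) cell_chain_upset by auto
    then have m: "mon m \<in> q" using 2(3) f(2) prime by blast
    have "poly_span (E \<union> cell m B) \<subseteq> q"
    proof (rule poly_span_subset_ideal[OF id])
      fix e assume "e \<in> E \<union> cell m B"
      then consider "e \<in> E" | p where "e = m + p" by (auto simp: mem_cell_iff)
      then show "mon e \<in> q"
      proof cases
        case 1
        then show ?thesis using 2(3) by auto
      next
        case 2
        then have "mon e = mon p * (mon m :: ('n, 'k) mpoly)" by (simp add: mult_single add.commute)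
        then show ?thesis using is_idealD(3)[OF id m] by simp
      qed
    qed
    then show ?thesis using 2 by simp
  qed simp
qed

text \<open>
  The cell is disjoint from \<open>E\<close>, and it absorbs all exponents supported in \<open>B\<close>, so \<open>E\<close> has no
  such exponents.
\<close>

lemma cell_chain_span_subset:
  assumes "cell_chain E L" "B \<in> set (map snd L)"
  shows "poly_span E \<subseteq> (var_prime B :: ('n::finite, 'k::field) mpoly set)"
proof -
  obtain m where m: "(m, B) \<in> set L" using assms(2) by auto
  have "\<exists>j. j \<notin> B \<and> lookup e j > 0" if e: "e \<in> E" for e
  proof (rule ccontr)
    assume "\<nexists>j. j \<notin> B \<and> lookup e j > 0"
    then have "m + e \<in> cell m B" by (auto simp: mem_cell_add)
    moreover have "m + e \<in> E"
      using upsetD[OF cell_chain_upset[OF assms(1)] e, of m] by (simp add: add.commute)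
    ultimately show False using cell_chain_disjoint[OF assms(1) m] by blast
  qed
  then show ?thesis by (auto simp: var_prime_def)
qed

text \<open>
  Below every prime in the support lies a prime of the filtration. So the minimal primes are among the
  primes of the filtration, and these are all minimal if and only if they form an antichain.
\<close>

lemma Min_primes_eq_iff_clean_cells:
  assumes chain: "cell_chain E L"
  shows "var_prime ` set (map snd L) = Min_primes (quot_mod S_mod (poly_span E :: ('n::finite, 'k::field) mpoly set))
    \<longleftrightarrow> clean_cells (map snd L)"
    (is "?V = ?Min \<longleftrightarrow> _")
proof -
  have Supp: "Supp (quot_mod S_mod (poly_span E :: ('n, 'k) mpoly set)) = {p. is_prime p \<and> poly_span E \<subseteq> p}"
    by (rule Supp_quot_S_mod[OF is_ideal_poly_span[OF cell_chain_upset[OF chain]]])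
  have V: "?V \<subseteq> {p. is_prime p \<and> poly_span E \<subseteq> p}"
    using cell_chain_span_subset[OF chain] is_prime_var_prime by blast
  have min: "?Min = {p. is_prime p \<and> poly_span E \<subseteq> p \<and> (\<forall>q. is_prime q \<and> poly_span E \<subseteq> q \<and> q \<subseteq> p \<longrightarrow> q = p)}"
    unfolding Min_primes_def Supp by blast
  show ?thesis
  proof
    assume eq: "?V = ?Min"
    show "clean_cells (map snd L)"
      unfolding clean_cells_def
    proof (intro ballI impI)
      fix B C assume BC: "B \<in> set (map snd L)" "C \<in> set (map snd L)" "B \<subseteq> C"
      then have "var_prime C \<subseteq> (var_prime B :: ('n, 'k) mpoly set)" by (simp add: var_prime_subset_iff)
      moreover have "var_prime B \<in> ?Min" "var_prime C \<in> ?V" using BC eq by blast+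
      ultimately have "var_prime C = (var_prime B :: ('n, 'k) mpoly set)"
        using V unfolding min by blast
      then show "B = C" by (simp add: var_prime_eq_iff)
    qed
  next
    assume clean: "clean_cells (map snd L)"
    show "?V = ?Min"
    proof (intro equalityI subsetI)
      fix p assume "p \<in> ?V"
      then obtain B where B: "B \<in> set (map snd L)" "p = var_prime B" by blast
      have "q = p" if q: "is_prime q" "poly_span E \<subseteq> q" "q \<subseteq> p" for q
      proof -
        obtain C where C: "C \<in> set (map snd L)" "var_prime C \<subseteq> q"
          using cell_chain_prime_contains[OF chain q(1,2)] by blast
        then have "var_prime C \<subseteq> (var_prime B :: ('n, 'k) mpoly set)" using q(3) B(2) by blast
        then have "B \<subseteq> C" by (simp add: var_prime_subset_iff)
        then have "B = C" using clean B C unfolding clean_cells_def by blast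
        then show ?thesis using C q(3) B(2) by blast
      qed
      then show "p \<in> ?Min" using V \<open>p \<in> ?V\<close> unfolding min by blast
    next
      fix p assume p: "p \<in> ?Min"
      then obtain C where C: "C \<in> set (map snd L)" "var_prime C \<subseteq> p"
        using cell_chain_prime_contains[OF chain] unfolding min by blast
      then have "var_prime C = p" using p V unfolding min by blast
      then show "p \<in> ?V" using C by blast
    qed
  qed
qed

text \<open>
  Let \<open>p = I : f\<close>. If some multiple of \<open>f\<close> by an element outside \<open>p\<close> lies in the next ideal of
  the filtration, then this multiple also has annihilator \<open>p\<close> modulo \<open>I\<close>; it is congruent to \<open>w
  x\<^sup>m\<close>, whose annihilator is the prime of the first cell. Otherwise \<open>p\<close> is also the colon
  ideal of \<open>f\<close> with respect to the next ideal.
\<close>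

lemma Ass_subset_cell_primes:
  fixes p :: "('n::finite, 'k::field) mpoly set"
  assumes "cell_chain E L" "is_prime p" "p = {s. s * f \<in> poly_span E}"
  shows "p \<in> var_prime ` set (map snd L)"
  using assms(1,3)
proof (induction E L rule: cell_chain.induct)
  case (1 E)
  then show ?case using assms(2) by (auto simp: is_prime_def)
next
  case (2 E m B L)
  have id: "is_ideal p" and one: "1 \<notin> p" and prime: "\<And>f g. f * g \<in> p \<Longrightarrow> f \<in> p \<or> g \<in> p"
    using assms(2) by (auto simp: is_prime_def)
  have up: "upset E" "upset (E \<union> cell m B)" and disj: "cell m B \<inter> E = {}"
    and chain: "cell_chain (E \<union> cell m B) L"
    using 2(2) cell_chain_upset by auto
  have idE: "is_ideal (poly_span E :: ('n, 'k) mpoly set)" by (rule is_ideal_poly_span[OF up(1)])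
  have p: "s \<in> p \<longleftrightarrow> s * f \<in> poly_span E" for s using 2(3) by blast
  show ?case
  proof (cases "\<exists>s. s \<notin> p \<and> s * f \<in> poly_span (E \<union> cell m B)")
    case True
    then obtain s where s: "s \<notin> p" "s * f \<in> poly_span (E \<union> cell m B)" by blast
    obtain w where w: "s * f - w * mon m \<in> poly_span E"
      using cell_division[OF s(2)] by blast
    have tw: "t \<in> p \<longleftrightarrow> t * w \<in> var_prime B" for t
    proof -
      have "t \<in> p \<longleftrightarrow> t * s \<in> p"
        using prime[of t s] s(1) is_idealD(6)[OF id] by blast
      also have "\<dots> \<longleftrightarrow> t * (s * f) \<in> poly_span E" by (simp add: p mult.assoc)
      also have "\<dots> \<longleftrightarrow> t * (w * mon m) \<in> poly_span E"
        using is_ideal_diff_cancel[OF idE, of "t * (s * f)" "t * (w * mon m)"]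
          is_idealD(3)[OF idE w, of t] by (simp add: right_diff_distrib)
      also have "\<dots> \<longleftrightarrow> t * w \<in> var_prime B"
        using mult_mon_mem_cell[OF up disj, of "t * w"] by (simp add: mult.assoc)
      finally show ?thesis .
    qed
    have "w \<notin> var_prime B" using tw[of 1] one by simp
    then have "t \<in> p \<longleftrightarrow> t \<in> var_prime B" for t
      using tw[of t] is_prime_var_prime[of B] is_idealD(6)[OF is_ideal_var_prime[of B]]
      unfolding is_prime_def by blast
    then have "p = var_prime B" by blast
    then show ?thesis by simp
  next
    case False
    have "poly_span E \<subseteq> (poly_span (E \<union> cell m B) :: ('n, 'k) mpoly set)" by simp
    then have "p = {s. s * f \<in> poly_span (E \<union> cell m B)}"
      using False p by blast
    then have "p \<in> var_prime ` set (map snd L)" by (rule 2(1)[OF chain])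
    then show ?thesis by auto
  qed
qed

text \<open>
  A colon ideal \<open>I : f\<close> which is a prime generated by variables is already the colon ideal of one of
  the monomials of \<open>f\<close>. For otherwise each monomial of \<open>f\<close> is multiplied into \<open>I\<close> by a monomial
  in the variables of \<open>B\<close>, and the product of these multiplies \<open>f\<close> into \<open>I\<close> without lying in the
  prime.
\<close>

lemma var_prime_mem_Ass_iff:
  fixes E :: "('n::finite \<Rightarrow>\<^sub>0 nat) set"
  assumes E: "upset E"
  shows "var_prime B \<in> Ass (quot_mod S_mod (poly_span E :: ('n, 'k::field) mpoly set)) \<longleftrightarrow> colon_prime E B"
proof
  assume "var_prime B \<in> Ass (quot_mod S_mod (poly_span E :: ('n, 'k) mpoly set))"
  then obtain f :: "('n, 'k) mpoly" where f: "var_prime B = {s. s * f \<in> poly_span E}"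
    by (auto simp: Ass_quot_S_mod[OF is_ideal_poly_span[OF E]])
  have f': "mon p * f \<in> poly_span E \<longleftrightarrow> (\<exists>j. j \<notin> B \<and> lookup p j > 0)" for p
    using f mem_var_prime[of "mon p" B] by auto
  have mult: "mon p * f \<in> poly_span E \<longleftrightarrow> (\<forall>w\<in>keys f. w + p \<in> E)" for p
    using mult_mon_mem_poly_span[of f p E] by (simp add: mult.commute add.commute)
  have "\<exists>w\<in>keys f. \<forall>p. (\<forall>j. j \<notin> B \<longrightarrow> lookup p j = 0) \<longrightarrow> w + p \<notin> E"
  proof (rule ccontr)
    assume "\<not> ?thesis"
    then have "\<forall>w\<in>keys f. \<exists>p. (\<forall>j. j \<notin> B \<longrightarrow> lookup p j = 0) \<and> w + p \<in> E" by blast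
    then obtain p where p: "\<forall>w\<in>keys f. (\<forall>j. j \<notin> B \<longrightarrow> lookup (p w) j = 0) \<and> w + p w \<in> E"
      by (rule bchoice[THEN exE])
    define p' where "p' = (\<Sum>w\<in>keys f. p w)"
    have "w + p' \<in> E" if w: "w \<in> keys f" for w
    proof -
      have "w + p' = (w + p w) + (\<Sum>w'\<in>keys f - {w}. p w')"
        using w by (simp add: p'_def sum.remove[of _ w] add.assoc)
      then show ?thesis using upsetD[OF E, of "w + p w"] p w by simp
    qed
    then have "mon p' * f \<in> poly_span E" using mult by blast
    moreover have "lookup p' j = 0" if "j \<notin> B" for j
      using p that by (simp add: p'_def lookup_sum)
    ultimately show False using f'[of p'] by auto
  qed
  then obtain w where w: "w \<in> keys f" "\<And>p. (\<forall>j. j \<notin> B \<longrightarrow> lookup p j = 0) \<Longrightarrow> w + p \<notin> E"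
    by blast
  have "w + p \<in> E \<longleftrightarrow> (\<exists>j. j \<notin> B \<and> lookup p j > 0)" for p
  proof
    assume "w + p \<in> E"
    then show "\<exists>j. j \<notin> B \<and> lookup p j > 0" using w(2)[of p] by (metis not_gr_zero)
  next
    assume "\<exists>j. j \<notin> B \<and> lookup p j > 0"
    then have "\<forall>w\<in>keys f. w + p \<in> E" by (simp only: f'[symmetric] mult)
    then show "w + p \<in> E" using w(1) by (rule bspec)
  qed
  then show "colon_prime E B" unfolding colon_prime_def by blast
next
  assume "colon_prime E B"
  then obtain w where w: "\<And>p. w + p \<in> E \<longleftrightarrow> (\<exists>j. j \<notin> B \<and> lookup p j > 0)"
    unfolding colon_prime_def by blast
  have "var_prime B = {s :: ('n, 'k) mpoly. s * mon w \<in> poly_span E}"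
    by (auto simp: mult_mon_mem_poly_span w mem_var_prime)
  then show "var_prime B \<in> Ass (quot_mod S_mod (poly_span E :: ('n, 'k) mpoly set))"
    using is_prime_var_prime unfolding Ass_quot_S_mod[OF is_ideal_poly_span[OF E]] by blast
qed

lemma Ass_eq_iff_almost_clean_cells:
  assumes chain: "cell_chain E L"
  shows "var_prime ` set (map snd L) = Ass (quot_mod S_mod (poly_span E :: ('n::finite, 'k::field) mpoly set))
    \<longleftrightarrow> almost_clean_cells E (map snd L)"
proof -
  have E: "upset E" by (rule cell_chain_upset[OF chain])
  have "Ass (quot_mod S_mod (poly_span E :: ('n, 'k) mpoly set)) \<subseteq> var_prime ` set (map snd L)"
    unfolding Ass_quot_S_mod[OF is_ideal_poly_span[OF E]]
    by (intro subsetI) (elim CollectE conjE exE, rule Ass_subset_cell_primes[OF chain])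
  then have "var_prime ` set (map snd L) = Ass (quot_mod S_mod (poly_span E :: ('n, 'k) mpoly set)) \<longleftrightarrow>
      var_prime ` set (map snd L) \<subseteq> Ass (quot_mod S_mod (poly_span E :: ('n, 'k) mpoly set))"
    by (simp add: set_eq_subset)
  also have "\<dots> \<longleftrightarrow> almost_clean_cells E (map snd L)"
    unfolding image_subset_iff almost_clean_cells_def var_prime_mem_Ass_iff[OF E] ..
  finally show ?thesis .
qed

section \<open>Cleanness in terms of cells\<close>

text \<open>
  The part that is common to the three characterizations: a condition \<open>R\<close> on the primes of a
  filtration that amounts to a condition \<open>Q\<close> on the sets of free variables of the corresponding
  cells.
\<close>

lemma prime_filtration_exists_iff:
  fixes E :: "('n::finite \<Rightarrow>\<^sub>0 nat) set"
  assumes E: "upset E"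
    and R: "\<And>L r F P. cell_chain E L \<Longrightarrow> length L = r \<Longrightarrow>
      (\<And>i. i < r \<Longrightarrow> P (Suc i) = (var_prime (snd (L ! i)) :: ('n, 'k::field) mpoly set)) \<Longrightarrow>
      R r P \<longleftrightarrow> Q (map snd L)"
  shows "(\<exists>r F P. prime_filtration (quot_mod S_mod (poly_span E :: ('n, 'k) mpoly set)) r F P \<and> R r P)
    \<longleftrightarrow> (\<exists>L. cell_chain E L \<and> Q (map snd L))"
proof
  assume "\<exists>r F P. prime_filtration (quot_mod S_mod (poly_span E :: ('n, 'k) mpoly set)) r F P \<and> R r P"
  then obtain r F and P :: "nat \<Rightarrow> ('n, 'k) mpoly set"
    where "prime_filtration (quot_mod S_mod (poly_span E)) r F P" and "R r P" by blast
  moreover from this(1) obtain L where L: "cell_chain E L" "length L = r"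
    "\<And>i. i < r \<Longrightarrow> P (Suc i) = var_prime (snd (L ! i))"
    using prime_filtration_imp_cell_chain[OF E] by blast
  ultimately show "\<exists>L. cell_chain E L \<and> Q (map snd L)"
    using R[OF L] by blast
next
  assume "\<exists>L. cell_chain E L \<and> Q (map snd L)"
  then obtain L where L: "cell_chain E L" "Q (map snd L)" by blast
  obtain F where "prime_filtration (quot_mod S_mod (poly_span E :: ('n, 'k) mpoly set)) (length L) F
      (\<lambda>i. var_prime (snd (L ! (i - 1))))"
    using cell_chain_imp_prime_filtration[OF L(1)] by blast
  moreover have "R (length L) (\<lambda>i. var_prime (snd (L ! (i - 1))))"
    using R[OF L(1), of "length L" "\<lambda>i. var_prime (snd (L ! (i - 1)))"] L(2) by simp
  ultimately show "\<exists>r F P. prime_filtration (quot_mod S_mod (poly_span E :: ('n, 'k) mpoly set)) r F P \<and> R r P"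
    by blast
qed

lemma primes_of_cells:
  assumes "length L = r" "\<And>i. i < r \<Longrightarrow> P (Suc i) = var_prime (snd (L ! i))"
  shows "P ` {1..r} = var_prime ` set (map snd L)"
proof -
  have "{1..r} = Suc ` {..<r}" by (simp add: image_Suc_lessThan)
  moreover have "set L = (\<lambda>i. L ! i) ` {..<r}"
    using assms(1) by (auto simp: set_conv_nth)
  then have "set (map snd L) = (\<lambda>i. snd (L ! i)) ` {..<r}"
    by (simp add: image_image)
  ultimately show ?thesis
    using assms(2) by (auto simp: image_image)
qed

lemma clean_iff_cells:
  fixes E :: "('n::finite \<Rightarrow>\<^sub>0 nat) set"
  assumes E: "upset E"
  shows "clean (quot_mod S_mod (poly_span E :: ('n, 'k::field) mpoly set)) \<longleftrightarrow>
    (\<exists>L. cell_chain E L \<and> clean_cells (map snd L))"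
  unfolding clean_def
  by (rule prime_filtration_exists_iff[OF E]) (simp only: primes_of_cells Min_primes_eq_iff_clean_cells)

lemma almost_clean_iff_cells:
  fixes E :: "('n::finite \<Rightarrow>\<^sub>0 nat) set"
  assumes E: "upset E"
  shows "almost_clean (quot_mod S_mod (poly_span E :: ('n, 'k::field) mpoly set)) \<longleftrightarrow>
    (\<exists>L. cell_chain E L \<and> almost_clean_cells E (map snd L))"
  unfolding almost_clean_def
  by (rule prime_filtration_exists_iff[OF E]) (simp only: primes_of_cells Ass_eq_iff_almost_clean_cells)

lemma pretty_clean_iff_cells:
  fixes E :: "('n::finite \<Rightarrow>\<^sub>0 nat) set"
  assumes E: "upset E"
  shows "pretty_clean (quot_mod S_mod (poly_span E :: ('n, 'k::field) mpoly set)) \<longleftrightarrow>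
    (\<exists>L. cell_chain E L \<and> pretty_clean_cells (map snd L))"
  unfolding pretty_clean_def
proof (rule prime_filtration_exists_iff[OF E])
  fix L r and P :: "nat \<Rightarrow> ('n, 'k) mpoly set"
  assume r: "length L = r" and P: "\<And>i. i < r \<Longrightarrow> P (Suc i) = var_prime (snd (L ! i))"
  have "(\<forall>i\<in>{1..r}. \<forall>j\<in>{1..r}. i < j \<and> P i \<subseteq> P j \<longrightarrow> P i = P j) \<longleftrightarrow>
      (\<forall>i<r. \<forall>j<r. i < j \<and> P (Suc i) \<subseteq> P (Suc j) \<longrightarrow> P (Suc i) = P (Suc j))"
  proof -
    have "{1..r} = Suc ` {..<r}" by (simp add: image_Suc_lessThan)
    then show ?thesis by (simp add: ball_simps(9) Ball_def[of "{..<r}"])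
  qed
  also have "\<dots> \<longleftrightarrow> (\<forall>i<r. \<forall>j<r. i < j \<and> snd (L ! j) \<subseteq> snd (L ! i) \<longrightarrow> snd (L ! i) = snd (L ! j))"
    by (auto simp: P var_prime_subset_iff var_prime_eq_iff)
  also have "\<dots> \<longleftrightarrow> sorted_wrt (\<lambda>c d. snd d \<subseteq> snd c \<longrightarrow> snd c = snd d) L"
    unfolding sorted_wrt_iff_nth_less r by (meson order.strict_trans)
  also have "\<dots> \<longleftrightarrow> pretty_clean_cells (map snd L)"
    by (simp add: pretty_clean_cells_def sorted_wrt_map)
  finally show "(\<forall>i\<in>{1..r}. \<forall>j\<in>{1..r}. i < j \<and> P i \<subseteq> P j \<longrightarrow> P i = P j) \<longleftrightarrow> pretty_clean_cells (map snd L)" .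
qed

definition same_cleanness ::
  "(('n::finite, 'k::field) mpoly, 'm, 'n) mgmodule \<Rightarrow> (('n, 'k) mpoly, 'l, 'n) mgmodule \<Rightarrow> bool" where
  "same_cleanness M N \<longleftrightarrow> (clean M \<longleftrightarrow> clean N) \<and> (pretty_clean M \<longleftrightarrow> pretty_clean N) \<and>
     (almost_clean M \<longleftrightarrow> almost_clean N)"

text \<open>
  The case of a single monomial. The assumption \<open>u \<noteq> 0\<close> excludes the unit \<open>x\<^sup>u = 1\<close>,
  for which there is no direction to slice in.
\<close>

lemma same_cleanness_adjoin_regular:
  fixes E :: "('n::finite \<Rightarrow>\<^sub>0 nat) set"
  assumes E: "upset E" "regular_expo u E" and u: "u \<noteq> 0"
  shows "same_cleanness (quot_mod S_mod (poly_span E :: ('n, 'k::field) mpoly set))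
    (quot_mod S_mod (poly_span (E \<union> cell u UNIV) :: ('n, 'k) mpoly set))"
proof -
  have E': "upset (E \<union> cell u UNIV)" using E(1) upset_cell_UNIV by (rule upset_Un)
  note adj = cell_chain_adjoin[OF _ E(2)] and desc = cell_chain_descend[OF E u]
  show ?thesis
    unfolding same_cleanness_def clean_iff_cells[OF E(1)] clean_iff_cells[OF E']
      pretty_clean_iff_cells[OF E(1)] pretty_clean_iff_cells[OF E']
      almost_clean_iff_cells[OF E(1)] almost_clean_iff_cells[OF E']
    by (intro conjI iffI; elim exE conjE) (metis adj desc)+
qed

section \<open>Regular sequences\<close>

text \<open>
  This identifies \<open>(S/I)/(A)(S/I)\<close> with \<open>S/(I, A)\<close>, so that regularity on \<open>S/I\<close> becomes a
  condition on colon ideals in \<open>S\<close>.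
\<close>

lemma ideal_mult_quot_S_mod:
  fixes I :: "('n::finite, 'k::field) mpoly set"
  assumes I: "is_ideal I"
  shows "ideal_mult A (quot_mod S_mod I) = coset I ` (Idl\<^bsub>S_ring\<^esub> (I \<union> A))"
proof -
  interpret R: cring "S_ring :: ('n, 'k) mpoly ring" by (rule S_ring_cring)
  interpret subquotient UNIV I "coset I" "quot_mod S_mod I"
    by (rule subquotient_quot_S_mod[OF I])
  let ?J = "Idl\<^bsub>S_ring\<^esub> (I \<union> A)"
  have J: "is_ideal ?J" using R.genideal_ideal[of "I \<union> A"] by (simp add: ideal_S_ring_iff)
  have AJ: "I \<union> A \<subseteq> ?J" by (rule R.genideal_self) simp
  show ?thesis
    unfolding ideal_mult_def
  proof (intro equalityI Inter_greatest)
    have "submodule (coset I ` ?J) S_ring (quot_mod S_mod I)"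
      by (rule submodule_image[OF J]) simp
    moreover have "\<forall>s\<in>A. \<forall>x\<in>carrier (quot_mod S_mod I). s \<odot>\<^bsub>quot_mod S_mod I\<^esub> x \<in> coset I ` ?J"
      using AJ is_idealD(6)[OF J] by (auto simp: carrier_eq smult_eq)
    ultimately show "\<Inter> {N. submodule N S_ring (quot_mod S_mod I) \<and> (\<forall>s\<in>A. \<forall>x\<in>carrier (quot_mod S_mod I). s \<odot>\<^bsub>quot_mod S_mod I\<^esub> x \<in> N)} \<subseteq> coset I ` ?J"
      by (intro Inter_lower) simp
  next
    fix N assume "N \<in> {N. submodule N S_ring (quot_mod S_mod I) \<and> (\<forall>s\<in>A. \<forall>x\<in>carrier (quot_mod S_mod I). s \<odot>\<^bsub>quot_mod S_mod I\<^esub> x \<in> N)}"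
    then have N: "submodule N S_ring (quot_mod S_mod I)"
      and AN: "\<And>s f. s \<in> A \<Longrightarrow> coset I (s * f) \<in> N"
      by (auto simp: carrier_eq smult_eq)
    have "I \<union> A \<subseteq> preim N"
      using preim_submodule(2)[OF N] AN[of _ 1] by (auto simp: preim_def)
    then have "?J \<subseteq> preim N"
      using preim_submodule(1)[OF N] by (intro R.genideal_minimal) (simp_all add: ideal_S_ring_iff)
    then show "coset I ` ?J \<subseteq> N" by (auto simp: preim_def)
  qed
qed

lemma nonzerodivisor_on_quot:
  fixes I :: "('n::finite, 'k::field) mpoly set"
  assumes I: "is_ideal I" and J: "is_ideal J" "I \<subseteq> J"
  shows "nonzerodivisor_on u (quot_mod (quot_mod S_mod I) (coset I ` J)) \<longleftrightarrow> (\<forall>f. u * f \<in> J \<longrightarrow> f \<in> J)"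
proof -
  let ?c = "\<lambda>f. coset I ` J +>\<^bsub>quot_mod S_mod I\<^esub> coset I f"
  interpret subquotient UNIV J ?c "quot_mod (quot_mod S_mod I) (coset I ` J)"
    by (rule subquotient.quot_mod[OF subquotient_quot_S_mod[OF I] J]) simp
  show ?thesis
    by (auto simp: nonzerodivisor_on_def carrier_eq smult_eq zero_eq eq_zero_iff)
qed

lemma genideal_Un_genideal:
  "Idl\<^bsub>S_ring\<^esub> (A \<union> B) = Idl\<^bsub>S_ring\<^esub> (Idl\<^bsub>S_ring\<^esub> A \<union> (B :: ('n::finite, 'k::field) mpoly set))"
proof -
  interpret R: cring "S_ring :: ('n, 'k) mpoly ring" by (rule S_ring_cring)
  have self: "C \<subseteq> Idl\<^bsub>S_ring\<^esub> C" for C :: "('n, 'k) mpoly set" by (rule R.genideal_self) simp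
  have id: "ideal (Idl\<^bsub>S_ring\<^esub> C) S_ring" for C :: "('n, 'k) mpoly set" by (rule R.genideal_ideal) simp
  show ?thesis
  proof
    show "Idl\<^bsub>S_ring\<^esub> (A \<union> B) \<subseteq> Idl\<^bsub>S_ring\<^esub> (Idl\<^bsub>S_ring\<^esub> A \<union> B)"
      using self[of A] self[of "Idl\<^bsub>S_ring\<^esub> A \<union> B"] by (intro R.genideal_minimal id) blast
    have "Idl\<^bsub>S_ring\<^esub> A \<subseteq> Idl\<^bsub>S_ring\<^esub> (A \<union> B)"
      using self[of "A \<union> B"] by (intro R.genideal_minimal id) blast
    then show "Idl\<^bsub>S_ring\<^esub> (Idl\<^bsub>S_ring\<^esub> A \<union> B) \<subseteq> Idl\<^bsub>S_ring\<^esub> (A \<union> B)"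
      using self[of "A \<union> B"] by (intro R.genideal_minimal id) blast
  qed
qed

theorem theorem2p6:
  fixes I :: "('n::finite, 'k::field) mpoly set"
    and us :: "('n, 'k) mpoly list"
  assumes "monomial_ideal I"
    and "set us \<subseteq> monomials"
    and "regular_sequence us (quot_mod S_mod I)"
  shows "(clean (quot_mod S_mod I) \<longleftrightarrow>
            clean (quot_mod S_mod (Idl\<^bsub>S_ring\<^esub> (I \<union> set us)))) \<and>
         (pretty_clean (quot_mod S_mod I) \<longleftrightarrow>
            pretty_clean (quot_mod S_mod (Idl\<^bsub>S_ring\<^esub> (I \<union> set us)))) \<and>
         (almost_clean (quot_mod S_mod I) \<longleftrightarrow>
            almost_clean (quot_mod S_mod (Idl\<^bsub>S_ring\<^esub> (I \<union> set us))))"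
proof -
  interpret R: cring "S_ring :: ('n, 'k) mpoly ring" by (rule S_ring_cring)
  obtain E where E: "upset E" "I = poly_span E"
    using monomial_ideal_poly_span[OF assms(1)] .
  have I: "is_ideal I" using E by (simp add: is_ideal_poly_span)
  interpret subquotient UNIV I "coset I" "quot_mod S_mod I"
    by (rule subquotient_quot_S_mod[OF I])
  define J where "J k = Idl\<^bsub>S_ring\<^esub> (I \<union> set (take k us))" for k
  have Jid: "is_ideal (J k)" for k
    using R.genideal_ideal[of "I \<union> set (take k us)"] by (simp add: J_def ideal_S_ring_iff)
  have Jself: "I \<union> set (take k us) \<subseteq> J k" for k
    unfolding J_def by (rule R.genideal_self) simp
  have proper: "1 \<notin> J (length us)"
  proof
    assume "1 \<in> J (length us)"
    then have "f \<in> J (length us)" for f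
      using is_idealD(3)[OF Jid, of 1 "length us" f] by simp
    then have "J (length us) = UNIV" by blast
    then have "ideal_mult (set us) (quot_mod S_mod I) = carrier (quot_mod S_mod I)"
      by (simp add: ideal_mult_quot_S_mod[OF I] J_def carrier_eq)
    then show False using assms(3) by (simp add: regular_sequence_def)
  qed
  have "\<exists>E'. upset E' \<and> J k = poly_span E' \<and> same_cleanness (quot_mod S_mod I) (quot_mod S_mod (J k))"
    if "k \<le> length us" for k
    using that
  proof (induction k)
    case 0
    have "J 0 = I"
      using R.genideal_minimal[of I I] R.genideal_self[of I] I by (simp add: J_def ideal_S_ring_iff)
    then show ?case using E by (auto simp: same_cleanness_def)
  next
    case (Suc k)
    then obtain E' where E': "upset E'" "J k = poly_span E'"
      and same: "same_cleanness (quot_mod S_mod I) (quot_mod S_mod (J k))"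
      by auto
    have k: "k < length us" using Suc by simp
    then have "us ! k \<in> monomials" using assms(2) by (auto dest: nth_mem)
    then obtain u where u: "us ! k = mon u" by (auto simp: monomials_def)
    have "nonzerodivisor_on (us ! k) (quot_mod (quot_mod S_mod I) (ideal_mult (set (take k us)) (quot_mod S_mod I)))"
      using assms(3) k by (simp add: regular_sequence_def)
    then have nzd: "mon u * f \<in> J k \<Longrightarrow> f \<in> J k" for f
      using nonzerodivisor_on_quot[OF I Jid[of k]] Jself[of k]
      by (simp add: ideal_mult_quot_S_mod[OF I] u flip: J_def)
    have "regular_expo u E'"
      unfolding regular_expo_def
    proof (intro allI impI)
      fix p assume "u + p \<in> E'"
      then have "mon u * mon p \<in> J k" by (simp add: E' mult_single)
      then have "mon p \<in> J k" by (rule nzd)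
      then show "p \<in> E'" by (simp add: E')
    qed
    \<comment> \<open>A regular sequence generates a proper ideal.\<close>
    moreover have "u \<noteq> 0"
    proof
      assume "u = 0"
      then have "us ! k = 1" using u by simp
      then have "1 \<in> set us" using k nth_mem by metis
      then show False using proper Jself[of "length us"] by auto
    qed
    moreover have "J (Suc k) = poly_span (E' \<union> cell u UNIV)"
    proof -
      have "J (Suc k) = Idl\<^bsub>S_ring\<^esub> ((I \<union> set (take k us)) \<union> {mon u})"
        unfolding J_def using k by (simp add: take_Suc_conv_app_nth u)
      also have "\<dots> = Idl\<^bsub>S_ring\<^esub> (J k \<union> {mon u})"
        unfolding J_def by (rule genideal_Un_genideal)
      finally show ?thesis
        by (simp only: E'(2) genideal_insert_monom[OF E'(1)])
    qed
    ultimately have "same_cleanness (quot_mod S_mod (J k)) (quot_mod S_mod (J (Suc k)))"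
      "upset (E' \<union> cell u UNIV)" "J (Suc k) = poly_span (E' \<union> cell u UNIV)"
      using same_cleanness_adjoin_regular[OF E'(1), of u, where 'k = 'k] upset_Un[OF E'(1) upset_cell_UNIV] E'(2)
      by simp_all
    then show ?case using same unfolding same_cleanness_def by blast
  qed
  from this[of "length us"] have "same_cleanness (quot_mod S_mod I) (quot_mod S_mod (J (length us)))"
    by blast
  then show ?thesis by (simp add: same_cleanness_def J_def)
qed

end
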